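(* Let $k$ be an infinite field, let $(A_i)_{i\in I}$ be a family of $k$-algebras, let $B$ be a $k$-algebra, and let $f:A=\prod_{i\in I} A_i\to B$ be a surjective $k$-algebra homomorphism. Suppose further that at least one of the following holds: (i) $\dim_k(B)<\mathrm{card}(k)$ and $\mathrm{card}(I)\leq\mathrm{card}(k)$; or (ii) $\dim_k(B)<2^{\aleph_0}$ and $\mathrm{card}(I)=\aleph_0$; or (iii) $\dim_k(B)$ is finite, and $\mathrm{card}(I)$ is less than every measurable cardinal $>\mathrm{card}(k)$ (if any exist). Then $$B\ =\ f(A_{\mathrm{fin}})+Z(B).$$ In fact, $f$ can be written as the sum $f=f_1+f_0$ of a $k$-algebra homomorphism $f_1:A\to B$ that factors through the projection of $A$ onto the product of finitely many of the $A_i$, and a $k$-algebra homomorphism $f_0:A\to Z(B)$.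
   Context: A $k$-algebra is a $k$-vector space $A$ with a $k$-bilinear multiplication $A\times A\to A$, not assumed associative or unital. The total annihilator ideal of an algebra $B$ is $Z(B)=\{x\in B\mid xB=Bx=\{0\}\}$. Products of algebras carry componentwise operations. For $a=(a_i)\in A=\prod_{i\in I}A_i$, $\mathrm{supp}(a)=\{i\in I\mid a_i\neq 0\}$, and $A_{\mathrm{fin}}=\{a\in A\mid \mathrm{supp}(a)\text{ is finite}\}$. A measurable cardinal is a cardinal $\mu$ admitting a nonprincipal $\mu$-complete ultrafilter (closed under intersections of fewer than $\mu$ members); by convention $\aleph_0$ is counted as measurable (which is irrelevant here for cardinals $>\mathrm{card}(k)$, as $k$ is infinite). *)

theory Defs
  imports "HOL-Algebra.AbelCoset" "HOL-Algebra.Module"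
begin

unbundle cardinal_syntax

section \<open>Algebras that need be neither associative nor unital\<close>

text \<open>The library records are reused as carriers of the structure: an algebra is a
  \<open>module\<close> record, whose field \<open>one\<close> is never constrained and never used.\<close>

locale nonassoc_algebra = module +
  assumes mult_closed:
      "\<lbrakk>x \<in> carrier M; y \<in> carrier M\<rbrakk> \<Longrightarrow> x \<otimes>\<^bsub>M\<^esub> y \<in> carrier M"
    and mult_l_distr:
      "\<lbrakk>x \<in> carrier M; y \<in> carrier M; z \<in> carrier M\<rbrakk> \<Longrightarrow>
        (x \<oplus>\<^bsub>M\<^esub> y) \<otimes>\<^bsub>M\<^esub> z = x \<otimes>\<^bsub>M\<^esub> z \<oplus>\<^bsub>M\<^esub> y \<otimes>\<^bsub>M\<^esub> z"
    and mult_r_distr: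
      "\<lbrakk>x \<in> carrier M; y \<in> carrier M; z \<in> carrier M\<rbrakk> \<Longrightarrow>
        x \<otimes>\<^bsub>M\<^esub> (y \<oplus>\<^bsub>M\<^esub> z) = x \<otimes>\<^bsub>M\<^esub> y \<oplus>\<^bsub>M\<^esub> x \<otimes>\<^bsub>M\<^esub> z"
    and smult_mult_l:
      "\<lbrakk>a \<in> carrier R; x \<in> carrier M; y \<in> carrier M\<rbrakk> \<Longrightarrow>
        (a \<odot>\<^bsub>M\<^esub> x) \<otimes>\<^bsub>M\<^esub> y = a \<odot>\<^bsub>M\<^esub> (x \<otimes>\<^bsub>M\<^esub> y)"
    and smult_mult_r:
      "\<lbrakk>a \<in> carrier R; x \<in> carrier M; y \<in> carrier M\<rbrakk> \<Longrightarrow>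
        x \<otimes>\<^bsub>M\<^esub> (a \<odot>\<^bsub>M\<^esub> y) = a \<odot>\<^bsub>M\<^esub> (x \<otimes>\<^bsub>M\<^esub> y)"

definition alg_hom ::
    "('k, 'm) ring_scheme \<Rightarrow> ('k, 'a, 'n) module_scheme \<Rightarrow> ('k, 'b, 'p) module_scheme \<Rightarrow> ('a \<Rightarrow> 'b) set"
  where "alg_hom K A B = {f \<in> carrier A \<rightarrow> carrier B.
    (\<forall>x\<in>carrier A. \<forall>y\<in>carrier A. f (x \<oplus>\<^bsub>A\<^esub> y) = f x \<oplus>\<^bsub>B\<^esub> f y) \<and>
    (\<forall>c\<in>carrier K. \<forall>x\<in>carrier A. f (c \<odot>\<^bsub>A\<^esub> x) = c \<odot>\<^bsub>B\<^esub> f x) \<and>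
    (\<forall>x\<in>carrier A. \<forall>y\<in>carrier A. f (x \<otimes>\<^bsub>A\<^esub> y) = f x \<otimes>\<^bsub>B\<^esub> f y)}"

definition prod_alg :: "'i set \<Rightarrow> ('i \<Rightarrow> ('k, 'a, 'n) module_scheme) \<Rightarrow> ('k, 'i \<Rightarrow> 'a) module"
  where "prod_alg I A =
    \<lparr>carrier = (\<Pi>\<^sub>E i\<in>I. carrier (A i)),
     mult = (\<lambda>x y. \<lambda>i\<in>I. x i \<otimes>\<^bsub>A i\<^esub> y i),
     one = (\<lambda>i\<in>I. \<one>\<^bsub>A i\<^esub>),
     zero = (\<lambda>i\<in>I. \<zero>\<^bsub>A i\<^esub>),
     add = (\<lambda>x y. \<lambda>i\<in>I. x i \<oplus>\<^bsub>A i\<^esub> y i),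
     smult = (\<lambda>c x. \<lambda>i\<in>I. c \<odot>\<^bsub>A i\<^esub> x i)\<rparr>"

definition supp :: "'i set \<Rightarrow> ('i \<Rightarrow> ('k, 'a, 'n) module_scheme) \<Rightarrow> ('i \<Rightarrow> 'a) \<Rightarrow> 'i set"
  where "supp I A a = {i \<in> I. a i \<noteq> \<zero>\<^bsub>A i\<^esub>}"

definition fin_supp :: "'i set \<Rightarrow> ('i \<Rightarrow> ('k, 'a, 'n) module_scheme) \<Rightarrow> ('i \<Rightarrow> 'a) set"
  where "fin_supp I A = {a \<in> carrier (prod_alg I A). finite (supp I A a)}"

definition tot_ann :: "('k, 'b, 'n) module_scheme \<Rightarrow> 'b set"
  where "tot_ann B =
    {x \<in> carrier B. \<forall>y\<in>carrier B. x \<otimes>\<^bsub>B\<^esub> y = \<zero>\<^bsub>B\<^esub> \<and> y \<otimes>\<^bsub>B\<^esub> x = \<zero>\<^bsub>B\<^esub>}"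

definition tot_ann_alg :: "('k, 'b, 'n) module_scheme \<Rightarrow> ('k, 'b, 'n) module_scheme"
  where "tot_ann_alg B = B\<lparr>carrier := tot_ann B\<rparr>"


section \<open>Dimension as a cardinal\<close>

definition lin_span :: "('k, 'm) ring_scheme \<Rightarrow> ('k, 'b, 'n) module_scheme \<Rightarrow> 'b set \<Rightarrow> 'b set"
  where "lin_span K M S =
    {(\<Oplus>\<^bsub>M\<^esub>v\<in>F. c v \<odot>\<^bsub>M\<^esub> v) | F c. finite F \<and> F \<subseteq> S \<and> c \<in> F \<rightarrow> carrier K}"

definition lin_indep :: "('k, 'm) ring_scheme \<Rightarrow> ('k, 'b, 'n) module_scheme \<Rightarrow> 'b set \<Rightarrow> bool"
  where "lin_indep K M S \<longleftrightarrow> S \<subseteq> carrier M \<and>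
    (\<forall>F c. finite F \<and> F \<subseteq> S \<and> c \<in> F \<rightarrow> carrier K \<and>
       (\<Oplus>\<^bsub>M\<^esub>v\<in>F. c v \<odot>\<^bsub>M\<^esub> v) = \<zero>\<^bsub>M\<^esub> \<longrightarrow> (\<forall>v\<in>F. c v = \<zero>\<^bsub>K\<^esub>))"

definition lin_basis :: "('k, 'm) ring_scheme \<Rightarrow> ('k, 'b, 'n) module_scheme \<Rightarrow> 'b set \<Rightarrow> bool"
  where "lin_basis K M S \<longleftrightarrow> lin_indep K M S \<and> lin_span K M S = carrier M"

definition vdim :: "('k, 'm) ring_scheme \<Rightarrow> ('k, 'b, 'n) module_scheme \<Rightarrow> 'b rel"
  where "vdim K M = |SOME S. lin_basis K M S|"

text \<open>The choice in \<^const>\<open>vdim\<close> is never vacuous over a field:\<close>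

lemma lin_basis_exists:
  assumes "field K" "module K M"
  shows "\<exists>S. lin_basis K M S"
proof -
  interpret F: field K by fact
  interpret module K M by fact
  define P where "P = {S. lin_indep K M S}"
  have "\<exists>S\<in>P. \<forall>X\<in>P. S \<subseteq> X \<longrightarrow> X = S"
  proof (rule subset_Zorn')
    fix C assume C: "subset.chain P C"
    have sub: "C \<subseteq> P" and lin: "\<And>X Y. X \<in> C \<Longrightarrow> Y \<in> C \<Longrightarrow> X \<subseteq> Y \<or> Y \<subseteq> X"
      using C by (auto simp: subset_chain_def)
    show "\<Union>C \<in> P"
      unfolding P_def mem_Collect_eq lin_indep_def
    proof (intro conjI allI impI)
      show "\<Union>C \<subseteq> carrier M" using sub by (auto simp: P_def lin_indep_def)
      fix F c
      assume F: "finite F \<and> F \<subseteq> \<Union>C \<and> c \<in> F \<rightarrow> carrier K \<and>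
        (\<Oplus>\<^bsub>M\<^esub>v\<in>F. c v \<odot>\<^bsub>M\<^esub> v) = \<zero>\<^bsub>M\<^esub>"
      show "\<forall>v\<in>F. c v = \<zero>\<^bsub>K\<^esub>"
      proof (cases "F = {}")
        case False
        then have "C \<noteq> {}" using F by auto
        then obtain X where "X \<in> C" "F \<subseteq> X"
          using finite_subset_Union_chain[of F C P] F C by auto
        then show ?thesis using sub F by (auto simp: P_def lin_indep_def)
      qed simp
    qed
  qed
  then obtain S where S: "lin_indep K M S"
    and max: "\<And>X. lin_indep K M X \<Longrightarrow> S \<subseteq> X \<Longrightarrow> X = S"
    unfolding P_def by auto
  have SM: "S \<subseteq> carrier M" using S by (simp add: lin_indep_def)
  have cl: "(\<Oplus>\<^bsub>M\<^esub>v\<in>F. c v \<odot>\<^bsub>M\<^esub> v) \<in> carrier M" if "F \<subseteq> carrier M" "c \<in> F \<rightarrow> carrier K" for F c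
    using that by (intro M.finsum_closed) auto
  have "lin_span K M S = carrier M"
  proof
    show "lin_span K M S \<subseteq> carrier M" using cl SM by (fastforce simp: lin_span_def)
    show "carrier M \<subseteq> lin_span K M S"
    proof (rule subsetI, rule ccontr)
      fix x assume x: "x \<in> carrier M" and nx: "x \<notin> lin_span K M S"
      have "x \<notin> S"
      proof
        assume "x \<in> S"
        then have "x = (\<Oplus>\<^bsub>M\<^esub>v\<in>{x}. \<one>\<^bsub>K\<^esub> \<odot>\<^bsub>M\<^esub> v)" using x by simp
        then have "x \<in> lin_span K M S" unfolding lin_span_def mem_Collect_eq using \<open>x \<in> S\<close>
          by (intro exI[of _ "{x}"] exI[of _ "\<lambda>_. \<one>\<^bsub>K\<^esub>"]) auto
        then show False using nx by simp
      qed
      have "lin_indep K M (insert x S)"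
        unfolding lin_indep_def
      proof (intro conjI allI impI)
        show "insert x S \<subseteq> carrier M" using x SM by auto
        fix F c
        assume F: "finite F \<and> F \<subseteq> insert x S \<and> c \<in> F \<rightarrow> carrier K \<and>
          (\<Oplus>\<^bsub>M\<^esub>v\<in>F. c v \<odot>\<^bsub>M\<^esub> v) = \<zero>\<^bsub>M\<^esub>"
        show "\<forall>v\<in>F. c v = \<zero>\<^bsub>K\<^esub>"
        proof (cases "x \<in> F")
          case False
          then show ?thesis using F S unfolding lin_indep_def by blast
        next
          case True
          define G where "G = F - {x}"
          have G: "finite G" "G \<subseteq> S" "x \<notin> G" "F = insert x G" "c \<in> G \<rightarrow> carrier K" "c x \<in> carrier K"
            using F True by (auto simp: G_def)
          have GM: "G \<subseteq> carrier M" using G SM by auto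
          define s where "s = (\<Oplus>\<^bsub>M\<^esub>v\<in>G. c v \<odot>\<^bsub>M\<^esub> v)"
          have sM: "s \<in> carrier M" unfolding s_def using cl GM G by blast
          have eq: "c x \<odot>\<^bsub>M\<^esub> x \<oplus>\<^bsub>M\<^esub> s = \<zero>\<^bsub>M\<^esub>"
          proof -
            have "(\<Oplus>\<^bsub>M\<^esub>v\<in>insert x G. c v \<odot>\<^bsub>M\<^esub> v) = c x \<odot>\<^bsub>M\<^esub> x \<oplus>\<^bsub>M\<^esub> s"
              unfolding s_def using G GM x by (intro M.finsum_insert) auto
            then show ?thesis using F G by simp
          qed
          show ?thesis
          proof (cases "c x = \<zero>\<^bsub>K\<^esub>")
            case True
            then have "s = \<zero>\<^bsub>M\<^esub>" using eq x sM by simp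
            then have "\<forall>v\<in>G. c v = \<zero>\<^bsub>K\<^esub>"
              using S G unfolding lin_indep_def s_def by blast
            then show ?thesis using True G by simp
          next
            case False
            define d where "d = inv\<^bsub>K\<^esub> (c x)"
            have d: "d \<in> carrier K" "d \<otimes>\<^bsub>K\<^esub> c x = \<one>\<^bsub>K\<^esub>"
              using False G by (auto simp: d_def F.field_Units)
            have "c x \<odot>\<^bsub>M\<^esub> x = \<ominus>\<^bsub>M\<^esub> s"
              using eq sM x G by (metis M.minus_equality smult_closed)
            then have "d \<odot>\<^bsub>M\<^esub> (c x \<odot>\<^bsub>M\<^esub> x) = (\<ominus>\<^bsub>K\<^esub> d) \<odot>\<^bsub>M\<^esub> s"
              using d sM by (simp add: smult_l_minus smult_r_minus)
            then have "x = (\<ominus>\<^bsub>K\<^esub> d) \<odot>\<^bsub>M\<^esub> s"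
              using d x G by (simp flip: smult_assoc1)
            also have "\<dots> = (\<Oplus>\<^bsub>M\<^esub>v\<in>G. (\<ominus>\<^bsub>K\<^esub> d) \<odot>\<^bsub>M\<^esub> (c v \<odot>\<^bsub>M\<^esub> v))"
              unfolding s_def using G GM d by (intro finsum_smult_ldistr) auto
            also have "\<dots> = (\<Oplus>\<^bsub>M\<^esub>v\<in>G. ((\<ominus>\<^bsub>K\<^esub> d) \<otimes>\<^bsub>K\<^esub> c v) \<odot>\<^bsub>M\<^esub> v)"
              using G GM d by (intro M.finsum_cong') (auto simp: smult_assoc1 Pi_iff subset_iff)
            finally have "x \<in> lin_span K M S"
              unfolding lin_span_def mem_Collect_eq using G d
              by (intro exI[of _ G] exI[of _ "\<lambda>v. (\<ominus>\<^bsub>K\<^esub> d) \<otimes>\<^bsub>K\<^esub> c v"]) auto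
            then show ?thesis using nx by simp
          qed
        qed
      qed
      then show False using max \<open>x \<notin> S\<close> by blast
    qed
  qed
  then show ?thesis using S by (auto simp: lin_basis_def)
qed

lemma vdim_basis:
  assumes "field K" "module K M"
  obtains S where "lin_basis K M S" "vdim K M = |S|"
  using someI_ex[OF lin_basis_exists[OF assms]] by (auto simp: vdim_def)


section \<open>Measurable cardinals\<close>

definition ultrafilter_on :: "'a set \<Rightarrow> 'a set set \<Rightarrow> bool"
  where "ultrafilter_on S U \<longleftrightarrow>
    U \<subseteq> Pow S \<and> S \<in> U \<and> {} \<notin> U \<and>
    (\<forall>X\<in>U. \<forall>Y. X \<subseteq> Y \<and> Y \<subseteq> S \<longrightarrow> Y \<in> U) \<and>
    (\<forall>X\<in>U. \<forall>Y\<in>U. X \<inter> Y \<in> U) \<and>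
    (\<forall>X. X \<subseteq> S \<longrightarrow> X \<in> U \<or> S - X \<in> U)"

definition nonprincipal_on :: "'a set \<Rightarrow> 'a set set \<Rightarrow> bool"
  where "nonprincipal_on S U \<longleftrightarrow> \<not> (\<exists>x\<in>S. U = {X. X \<subseteq> S \<and> x \<in> X})"

definition complete_for :: "'b rel \<Rightarrow> 'a set set \<Rightarrow> bool"
  where "complete_for \<mu> U \<longleftrightarrow> (\<forall>F. F \<subseteq> U \<and> F \<noteq> {} \<and> |F| <o \<mu> \<longrightarrow> \<Inter>F \<in> U)"

text \<open>A cardinal is a cardinal order in the sense of the library.  With this definition the
  countable cardinal is measurable and no finite cardinal is.\<close>

definition measurable_cardinal :: "'a rel \<Rightarrow> bool"
  where "measurable_cardinal \<mu> \<longleftrightarrow> Card_order \<mu> \<and>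
    (\<exists>U. ultrafilter_on (Field \<mu>) U \<and> nonprincipal_on (Field \<mu>) U \<and> complete_for \<mu> U)"

text \<open>Measurable cardinals above a given one that are represented on the type of the index set
  suffice: every cardinal not so represented exceeds that of every set over this type.\<close>

definition below_measurables :: "'i set \<Rightarrow> 'k set \<Rightarrow> bool"
  where "below_measurables I C \<longleftrightarrow>
    (\<forall>\<mu> :: 'i rel. measurable_cardinal \<mu> \<and> |C| <o \<mu> \<longrightarrow> |I| <o \<mu>)"

end

theory Submission
  imports Defs
begin

text \<open>For \<open>a \<in> A\<close> the map \<open>u \<mapsto> f (u a)\<close> from \<open>k\<^sup>I\<close> to \<open>B\<close> is linear.  If its kernel contains a \<open>u\<close> that
  vanishes only on a finite set \<open>F\<close>, then for \<open>b\<close> supported off \<open>F\<close> we get \<open>f a f b = f (u a) f (u\<^sup>-\<^sup>1 b) = 0\<close>,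
  so the part of \<open>a\<close> off \<open>F\<close> is sent into \<open>Z(B)\<close>.  Applied to one \<open>a\<close> assembled from bad components, this
  shows that all but finitely many \<open>A\<^sub>i\<close> are sent into \<open>Z(B)\<close>, and the theorem follows.

  To find \<open>u\<close> in case (i), embed \<open>I\<close> in \<open>k\<close> by \<open>c\<close>: the images of the \<open>card k\<close> functions \<open>1 / (t - c i)\<close> are
  linearly dependent, and a nonzero combination of them has finitely many zeros.  In case (ii), if
  \<open>card k < 2\<^sup>\<omega>\<close> then \<open>card B < 2\<^sup>\<omega>\<close>, and two of \<open>2\<^sup>\<omega>\<close> eventually different functions have the same image.
  In case (iii), take a maximal subspace \<open>Y\<close> of \<open>B\<close> all of whose elements are values of functions with
  support exactly some set \<open>E\<close>.  By maximality \<open>I - E\<close> has no infinite disjoint family of sets supporting values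
  outside \<open>Y\<close>.  If no function nonzero on a cofinite subset of \<open>I - E\<close> had its value in \<open>Y\<close>, then the sets
  supporting only values in \<open>Y\<close> would yield a nonprincipal ultrafilter, and partial fractions constant on
  the blocks of a partition make it closed under \<open>card k\<close> intersections, contradicting the bound on \<open>I\<close>.\<close>

section \<open>Partial fractions over a field\<close>

lemma (in ring) minus_eq_zero_iff:
  assumes "x \<in> carrier R" "y \<in> carrier R"
  shows "x \<ominus> y = \<zero> \<longleftrightarrow> x = y"
  using assms by (metis a_minus_def add.inv_solve_right' l_zero zero_closed)

text \<open>Serves to divide out a zero: if a constant plus a sum of such fractions vanishes at
  \<open>a\<close>, what remains is \<open>z \<ominus> a\<close> times a sum with the same
  poles.\<close>

lemma (in field) partial_fraction_diff:
  assumes "l \<in> carrier R" "t \<in> carrier R" "z \<in> carrier R" "a \<in> carrier R" "t \<noteq> z" "t \<noteq> a"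
  shows "l \<otimes> inv (t \<ominus> z) = l \<otimes> inv (t \<ominus> a) \<oplus> (z \<ominus> a) \<otimes> (l \<otimes> inv (t \<ominus> a) \<otimes> inv (t \<ominus> z))"
proof -
  define p q where "p = inv (t \<ominus> z)" and "q = inv (t \<ominus> a)"
  have nz: "t \<ominus> z \<noteq> \<zero>" "t \<ominus> a \<noteq> \<zero>" using assms minus_eq_zero_iff by auto
  have p: "p \<in> carrier R" "(t \<ominus> z) \<otimes> p = \<one>" and q: "q \<in> carrier R" "(t \<ominus> a) \<otimes> q = \<one>"
    using nz assms by (auto simp: p_def q_def field_Units)
  have "l \<otimes> q \<oplus> (z \<ominus> a) \<otimes> (l \<otimes> q \<otimes> p) = l \<otimes> q \<otimes> \<one> \<oplus> (l \<otimes> p \<otimes> ((t \<ominus> a) \<otimes> q) \<ominus> l \<otimes> q \<otimes> ((t \<ominus> z) \<otimes> p))"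
    using assms(1-4) p(1) q(1) by algebra
  also have "\<dots> = l \<otimes> p" unfolding p q using assms(1-4) p(1) q(1) by algebra
  finally show ?thesis by (simp add: p_def q_def)
qed

text \<open>Serves to remove a pole: for \<open>t = s\<close> only a constant remains, and for other
  \<open>t\<close> a constant is added and the numerator changes.\<close>

lemma (in field) partial_fraction_mult:
  assumes "l \<in> carrier R" "t \<in> carrier R" "z \<in> carrier R" "s \<in> carrier R" "t \<noteq> z"
  shows "(s \<ominus> z) \<otimes> (l \<otimes> inv (t \<ominus> z)) = l \<oplus> l \<otimes> (s \<ominus> t) \<otimes> inv (t \<ominus> z)"
proof -
  define p where "p = inv (t \<ominus> z)"
  have p: "p \<in> carrier R" "(t \<ominus> z) \<otimes> p = \<one>"
    using assms minus_eq_zero_iff[of t z] by (auto simp: p_def field_Units)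
  have "(s \<ominus> z) \<otimes> (l \<otimes> p) = l \<otimes> ((t \<ominus> z) \<otimes> p) \<oplus> l \<otimes> (s \<ominus> t) \<otimes> p"
    using assms(1-4) p(1) by algebra
  then show ?thesis using assms p by (simp add: p_def)
qed

text \<open>Induction on the number of poles instead of clearing denominators. Divide out one zero
  \<open>a\<close>, then multiply by \<open>s \<ominus> z\<close>: every other zero is a zero of a
  function of the same shape with poles in \<open>T\<close> only. The constant \<open>C\<close>
  keeps the shape stable.\<close>

lemma (in field) finite_partial_fraction_zeros:
  assumes "finite T" "T \<subseteq> carrier R" "C \<in> carrier R" "l \<in> T \<rightarrow> carrier R - {\<zero>}" "T \<noteq> {} \<or> C \<noteq> \<zero>"
  shows "finite {z \<in> carrier R - T. C \<oplus> (\<Oplus>t\<in>T. l t \<otimes> inv (t \<ominus> z)) = \<zero>}"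
  using assms
proof (induction T arbitrary: C l rule: finite_induct)
  case empty
  then show ?case by simp
next
  case (insert s T)
  have s: "s \<in> carrier R" "s \<notin> T" and T: "finite T" "T \<subseteq> carrier R" using insert by auto
  define Z where "Z = {z \<in> carrier R - insert s T. C \<oplus> (\<Oplus>t\<in>insert s T. l t \<otimes> inv (t \<ominus> z)) = \<zero>}"
  have inv: "inv (t \<ominus> z) \<in> carrier R - {\<zero>}" if "t \<in> carrier R" "z \<in> carrier R" "t \<noteq> z" for t z
    using that minus_eq_zero_iff[of t z] field_Units Units_inv_Units[of "t \<ominus> z"] by auto
  have "finite Z"
  proof (cases "Z = {}")
    case False
    then obtain a where a: "a \<in> Z" by blast
    have aR: "a \<in> carrier R" "a \<notin> insert s T" using a by (auto simp: Z_def)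
    define l1 where "l1 t = l t \<otimes> inv (t \<ominus> a)" for t
    have l: "l t \<in> carrier R" "l t \<noteq> \<zero>" if "t \<in> insert s T" for t using that insert.prems by auto
    have TR: "t \<in> carrier R" if "t \<in> insert s T" for t using that insert.prems by auto
    have l1: "l1 t \<in> carrier R" "l1 t \<noteq> \<zero>" if "t \<in> insert s T" for t
      using l[OF that] inv[OF TR[OF that], of a] aR that integral_iff by (auto simp: l1_def)
    define C' where "C' = (\<Oplus>t\<in>insert s T. l1 t)"
    define l2 where "l2 t = l1 t \<otimes> (s \<ominus> t)" for t
    have l2: "l2 t \<in> carrier R - {\<zero>}" if "t \<in> T" for t
      using l1[of t] TR[of t] that s minus_eq_zero_iff[of s t] integral_iff by (auto simp: l2_def)
    have C': "C' \<in> carrier R" unfolding C'_def using l1 by auto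
    \<comment> \<open>If \<open>T\<close> is empty, \<open>C'\<close> is the single term
      \<open>l1 s\<close>, which is nonzero; so the reduced function is again nontrivial.\<close>
    have "T \<noteq> {} \<or> C' \<noteq> \<zero>" using l1[of s] by (auto simp: C'_def)
    then have fin: "finite {z \<in> carrier R - T. C' \<oplus> (\<Oplus>t\<in>T. l2 t \<otimes> inv (t \<ominus> z)) = \<zero>}"
      using l2 T C' by (intro insert.IH) auto
    have "Z \<subseteq> insert a {z \<in> carrier R - T. C' \<oplus> (\<Oplus>t\<in>T. l2 t \<otimes> inv (t \<ominus> z)) = \<zero>}"
    proof
      fix z assume z: "z \<in> Z"
      have zR: "z \<in> carrier R" "z \<notin> insert s T" using z by (auto simp: Z_def)
      have iz: "inv (t \<ominus> z) \<in> carrier R" if "t \<in> insert s T" for t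
        using inv[of t z] TR[OF that] zR that by auto
      have ia: "inv (t \<ominus> a) \<in> carrier R" if "t \<in> insert s T" for t
        using inv[of t a] TR[OF that] aR that by auto
      define S where "S = (\<Oplus>t\<in>insert s T. l1 t \<otimes> inv (t \<ominus> z))"
      have SR: "S \<in> carrier R" unfolding S_def using l1 iz by auto
      have "(\<Oplus>t\<in>insert s T. l t \<otimes> inv (t \<ominus> z)) =
          (\<Oplus>t\<in>insert s T. l t \<otimes> inv (t \<ominus> a) \<oplus> (z \<ominus> a) \<otimes> (l1 t \<otimes> inv (t \<ominus> z)))"
        unfolding l1_def
      proof (intro add.finprod_cong')
        fix t assume "t \<in> insert s T"
        then show "l t \<otimes> inv (t \<ominus> z) = l t \<otimes> inv (t \<ominus> a) \<oplus> (z \<ominus> a) \<otimes> (l t \<otimes> inv (t \<ominus> a) \<otimes> inv (t \<ominus> z))"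
          using l TR zR aR by (intro partial_fraction_diff) auto
      qed (use l ia iz zR aR in auto)
      also have "\<dots> = (\<Oplus>t\<in>insert s T. l t \<otimes> inv (t \<ominus> a)) \<oplus> (\<Oplus>t\<in>insert s T. (z \<ominus> a) \<otimes> (l1 t \<otimes> inv (t \<ominus> z)))"
        using l ia iz zR aR l1 by (intro add.finprod_multf) auto
      also have "(\<Oplus>t\<in>insert s T. (z \<ominus> a) \<otimes> (l1 t \<otimes> inv (t \<ominus> z))) = (z \<ominus> a) \<otimes> S"
        unfolding S_def using T l1 iz zR aR by (intro finsum_rdistr[symmetric]) auto
      finally have eq: "(\<Oplus>t\<in>insert s T. l t \<otimes> inv (t \<ominus> z)) = (\<Oplus>t\<in>insert s T. l t \<otimes> inv (t \<ominus> a)) \<oplus> (z \<ominus> a) \<otimes> S" .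
      have Wa: "(\<Oplus>t\<in>insert s T. l t \<otimes> inv (t \<ominus> a)) \<in> carrier R" (is "?W \<in> _") using l ia by (intro finsum_closed) auto
      have "(C \<oplus> ?W) \<oplus> (z \<ominus> a) \<otimes> S = \<zero>"
        using z eq Wa SR zR aR insert.prems by (simp add: Z_def a_assoc)
      moreover have "C \<oplus> ?W = \<zero>" using a by (simp add: Z_def)
      ultimately have zS: "(z \<ominus> a) \<otimes> S = \<zero>" using SR zR aR by simp
      show "z \<in> insert a {z \<in> carrier R - T. C' \<oplus> (\<Oplus>t\<in>T. l2 t \<otimes> inv (t \<ominus> z)) = \<zero>}"
      proof (cases "z = a")
        case False
        then have S0: "S = \<zero>" using zS SR zR aR minus_eq_zero_iff[of z a] integral_iff by auto
        have "\<zero> = (s \<ominus> z) \<otimes> S" using S0 s zR by simp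
        also have "\<dots> = (\<Oplus>t\<in>insert s T. (s \<ominus> z) \<otimes> (l1 t \<otimes> inv (t \<ominus> z)))"
          unfolding S_def using T l1 iz zR s by (intro finsum_rdistr) auto
        also have "\<dots> = (\<Oplus>t\<in>insert s T. l1 t \<oplus> l2 t \<otimes> inv (t \<ominus> z))"
          unfolding l2_def
        proof (intro add.finprod_cong')
          fix t assume "t \<in> insert s T"
          then show "(s \<ominus> z) \<otimes> (l1 t \<otimes> inv (t \<ominus> z)) = l1 t \<oplus> l1 t \<otimes> (s \<ominus> t) \<otimes> inv (t \<ominus> z)"
            using l1 TR zR s by (intro partial_fraction_mult) auto
        qed (use l1 iz zR s TR in auto)
        also have "\<dots> = C' \<oplus> (\<Oplus>t\<in>insert s T. l2 t \<otimes> inv (t \<ominus> z))"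
          unfolding C'_def using l1 iz s TR by (intro add.finprod_multf) (auto simp: l2_def)
        also have "(\<Oplus>t\<in>insert s T. l2 t \<otimes> inv (t \<ominus> z)) = l2 s \<otimes> inv (s \<ominus> z) \<oplus> (\<Oplus>t\<in>T. l2 t \<otimes> inv (t \<ominus> z))"
          using T s l1 iz TR by (intro finsum_insert) (auto simp: l2_def)
        \<comment> \<open>The factor \<open>s \<ominus> s\<close> in \<open>l2 s\<close> removes the
          pole at \<open>s\<close>.\<close>
        also have "l2 s \<otimes> inv (s \<ominus> z) = \<zero>"
        proof -
          have "s \<ominus> s = \<zero>" using s by (simp add: a_minus_def r_neg)
          then show ?thesis using l1[of s] iz[of s] by (simp add: l2_def)
        qed
        also have "\<zero> \<oplus> (\<Oplus>t\<in>T. l2 t \<otimes> inv (t \<ominus> z)) = (\<Oplus>t\<in>T. l2 t \<otimes> inv (t \<ominus> z))"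
          using l2 iz by (intro l_zero finsum_closed) auto
        finally show ?thesis using zR by simp
      qed simp
    qed
    then show ?thesis using fin finite_subset by blast
  qed simp
  then show ?case by (simp add: Z_def)
qed


section \<open>Cardinality and linear dependence\<close>

lemma finite_ordLeq_infinite:
  assumes "finite A" "infinite B"
  shows "|A| \<le>o |B|"
  using assms ordLess_or_ordLeq[OF card_of_Well_order card_of_Well_order, of B A]
    ordLess_imp_ordLeq card_of_ordLeq_finite by blast

text \<open>A subset of size \<open>n + 1\<close> arises by insertion from a point of
  \<open>A\<close> and a subset of size \<open>n\<close>, so there are at most \<open>|A|\<close>
  subsets of each size; countably many sizes do not enlarge an infinite cardinal.\<close>

lemma card_of_Fpow_ordLeq:
  assumes "infinite A"
  shows "|Fpow A| \<le>o |A|"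
proof -
  have "|{B. B \<subseteq> A \<and> finite B \<and> card B = n}| \<le>o |A|" for n
  proof (induction n)
    case 0
    have "{B. B \<subseteq> A \<and> finite B \<and> card B = 0} = {{}}" by auto
    moreover have "|{{}}| \<le>o |A|" using assms by (intro card_of_singl_ordLeq) auto
    ultimately show ?case by (simp only:)
  next
    case (Suc n)
    let ?P = "{B. B \<subseteq> A \<and> finite B \<and> card B = n}"
    have "{B. B \<subseteq> A \<and> finite B \<and> card B = Suc n} \<subseteq> (\<lambda>(x, B). insert x B) ` (A \<times> ?P)"
    proof
      fix B assume "B \<in> {B. B \<subseteq> A \<and> finite B \<and> card B = Suc n}"
      then have B: "B \<subseteq> A" "finite B" "card B = Suc n" by auto
      then obtain x C where "B = insert x C" "x \<notin> C" "card C = n" using card_eq_SucD[of B n] by blast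
      then show "B \<in> (\<lambda>(x, B). insert x B) ` (A \<times> ?P)" using B by (intro image_eqI[of _ _ "(x, C)"]) auto
    qed
    then have "|{B. B \<subseteq> A \<and> finite B \<and> card B = Suc n}| \<le>o |A \<times> ?P|" by (rule surj_imp_ordLeq)
    also have "|A \<times> ?P| \<le>o |A|"
      using card_of_Times_ordLeq_infinite_Field[of "|A|" A ?P] Suc assms
      by (auto simp: Field_card_of card_of_card_order_on card_of_mono1)
    finally show ?case .
  qed
  then have "|\<Union>n\<in>(UNIV::nat set). {B. B \<subseteq> A \<and> finite B \<and> card B = n}| \<le>o |A|"
    using assms infinite_iff_card_of_nat by (intro card_of_UNION_ordLeq_infinite) auto
  moreover have "Fpow A = (\<Union>n\<in>(UNIV::nat set). {B. B \<subseteq> A \<and> finite B \<and> card B = n})"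
    by (auto simp: Fpow_def)
  ultimately show ?thesis by simp
qed

section \<open>Finite spans, dependent families and the size of a vector space\<close>

locale vspace = module K M + field K for K (structure) and M (structure)
begin

lemma finsum_smult_rdistr:
  assumes "x \<in> carrier M" "finite A" "c \<in> A \<rightarrow> carrier K"
  shows "(\<Oplus>\<^bsub>M\<^esub>t\<in>A. c t \<odot>\<^bsub>M\<^esub> x) = (\<Oplus>t\<in>A. c t) \<odot>\<^bsub>M\<^esub> x"
  using assms(2,3)
proof (induction A rule: finite_induct)
  case (insert a A)
  then have "(\<Oplus>\<^bsub>M\<^esub>t\<in>insert a A. c t \<odot>\<^bsub>M\<^esub> x) = c a \<odot>\<^bsub>M\<^esub> x \<oplus>\<^bsub>M\<^esub> (\<Oplus>\<^bsub>M\<^esub>t\<in>A. c t \<odot>\<^bsub>M\<^esub> x)"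
    using assms(1) by (intro M.finsum_insert) auto
  also have "\<dots> = (c a \<oplus> (\<Oplus>t\<in>A. c t)) \<odot>\<^bsub>M\<^esub> x"
    using insert assms(1) by (simp add: smult_l_distr Pi_iff)
  also have "c a \<oplus> (\<Oplus>t\<in>A. c t) = (\<Oplus>t\<in>insert a A. c t)"
    using insert by (intro R.finsum_insert[symmetric]) auto
  finally show ?case .
qed (use assms(1) in simp)

lemma lin_span_finite:
  assumes "finite F" "F \<subseteq> carrier M"
  shows "lin_span K M F = {(\<Oplus>\<^bsub>M\<^esub>v\<in>F. c v \<odot>\<^bsub>M\<^esub> v) | c. c \<in> F \<rightarrow> carrier K}" (is "_ = ?R")
proof
  show "?R \<subseteq> lin_span K M F" using assms(1) unfolding lin_span_def by blast
  show "lin_span K M F \<subseteq> ?R"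
  proof
    fix x assume "x \<in> lin_span K M F"
    then obtain G c where G: "G \<subseteq> F" "c \<in> G \<rightarrow> carrier K" "x = (\<Oplus>\<^bsub>M\<^esub>v\<in>G. c v \<odot>\<^bsub>M\<^esub> v)"
      unfolding lin_span_def by blast
    define d where "d v = (if v \<in> G then c v else \<zero>)" for v
    have d: "d \<in> F \<rightarrow> carrier K" using G by (auto simp: d_def)
    have "(\<Oplus>\<^bsub>M\<^esub>v\<in>G. d v \<odot>\<^bsub>M\<^esub> v) = (\<Oplus>\<^bsub>M\<^esub>v\<in>F. d v \<odot>\<^bsub>M\<^esub> v)"
      using assms G d by (intro M.add.finprod_mono_neutral_cong_left) (auto simp: d_def subset_iff Pi_iff)
    moreover have "(\<Oplus>\<^bsub>M\<^esub>v\<in>G. d v \<odot>\<^bsub>M\<^esub> v) = x"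
      unfolding G(3) using G assms by (intro M.finsum_cong') (auto simp: d_def)
    ultimately show "x \<in> ?R" using d by auto
  qed
qed

lemma lin_span_insertE:
  assumes "finite F" "insert x F \<subseteq> carrier M" "y \<in> lin_span K M (insert x F)"
  obtains c z where "c \<in> carrier K" "z \<in> lin_span K M F" "y = c \<odot>\<^bsub>M\<^esub> x \<oplus>\<^bsub>M\<^esub> z"
proof (cases "x \<in> F")
  case True
  have "y \<in> carrier M" using assms by (auto simp: lin_span_finite intro!: M.finsum_closed)
  moreover have "x \<in> carrier M" using assms by auto
  ultimately show ?thesis using that[of \<zero> y] True assms(3) by (simp add: insert_absorb)
next
  case False
  obtain c where c: "c \<in> insert x F \<rightarrow> carrier K" "y = (\<Oplus>\<^bsub>M\<^esub>v\<in>insert x F. c v \<odot>\<^bsub>M\<^esub> v)"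
    using assms by (auto simp: lin_span_finite)
  have "y = c x \<odot>\<^bsub>M\<^esub> x \<oplus>\<^bsub>M\<^esub> (\<Oplus>\<^bsub>M\<^esub>v\<in>F. c v \<odot>\<^bsub>M\<^esub> v)"
    unfolding c(2) using assms False c(1) by (intro M.finsum_insert) auto
  moreover have "(\<Oplus>\<^bsub>M\<^esub>v\<in>F. c v \<odot>\<^bsub>M\<^esub> v) \<in> lin_span K M F"
    using assms c(1) by (auto simp: lin_span_finite)
  ultimately show ?thesis using that[of "c x"] c by auto
qed

lemma lin_span_closed:
  assumes "finite F" "F \<subseteq> carrier M" "y \<in> lin_span K M F"
  shows "y \<in> carrier M"
  using assms by (auto simp: lin_span_finite intro!: M.finsum_closed)

lemma lin_span_diff_smult:
  assumes "finite F" "F \<subseteq> carrier M" "y \<in> lin_span K M F" "z \<in> lin_span K M F" "d \<in> carrier K"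
  shows "y \<ominus>\<^bsub>M\<^esub> d \<odot>\<^bsub>M\<^esub> z \<in> lin_span K M F"
proof -
  obtain a b where a: "a \<in> F \<rightarrow> carrier K" "y = (\<Oplus>\<^bsub>M\<^esub>v\<in>F. a v \<odot>\<^bsub>M\<^esub> v)"
    and b: "b \<in> F \<rightarrow> carrier K" "z = (\<Oplus>\<^bsub>M\<^esub>v\<in>F. b v \<odot>\<^bsub>M\<^esub> v)"
    using assms by (auto simp: lin_span_finite)
  have ab: "a v \<in> carrier K" "b v \<in> carrier K" "v \<in> carrier M" if "v \<in> F" for v
    using a b that assms by auto
  have "y \<ominus>\<^bsub>M\<^esub> d \<odot>\<^bsub>M\<^esub> z = y \<oplus>\<^bsub>M\<^esub> (\<ominus> d) \<odot>\<^bsub>M\<^esub> z"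
    using lin_span_closed assms by (simp add: a_minus_def smult_l_minus)
  also have "\<dots> = y \<oplus>\<^bsub>M\<^esub> (\<Oplus>\<^bsub>M\<^esub>v\<in>F. (\<ominus> d) \<odot>\<^bsub>M\<^esub> (b v \<odot>\<^bsub>M\<^esub> v))"
    unfolding b(2) using assms(1,5) ab by (subst finsum_smult_ldistr) auto
  also have "\<dots> = (\<Oplus>\<^bsub>M\<^esub>v\<in>F. a v \<odot>\<^bsub>M\<^esub> v \<oplus>\<^bsub>M\<^esub> (\<ominus> d) \<odot>\<^bsub>M\<^esub> (b v \<odot>\<^bsub>M\<^esub> v))"
    unfolding a(2) using ab assms by (intro M.add.finprod_multf[symmetric]) auto
  also have "\<dots> = (\<Oplus>\<^bsub>M\<^esub>v\<in>F. (a v \<oplus> (\<ominus> d) \<otimes> b v) \<odot>\<^bsub>M\<^esub> v)"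
    using ab assms by (intro M.finsum_cong') (auto simp: smult_l_distr smult_assoc1)
  finally show ?thesis using ab assms
    by (simp add: lin_span_finite) (rule exI[of _ "\<lambda>v. a v \<oplus> (\<ominus> d) \<otimes> b v"], auto)
qed

text \<open>Dependence of an indexed family, so that a repeated vector already counts.\<close>

definition dependent :: "'t set \<Rightarrow> ('t \<Rightarrow> 'c) \<Rightarrow> bool"
  where "dependent T v \<longleftrightarrow> (\<exists>A l. finite A \<and> A \<subseteq> T \<and> A \<noteq> {} \<and> l \<in> A \<rightarrow> carrier K - {\<zero>} \<and>
    (\<Oplus>\<^bsub>M\<^esub>t\<in>A. l t \<odot>\<^bsub>M\<^esub> v t) = \<zero>\<^bsub>M\<^esub>)"

lemma dependentE:
  assumes "dependent T v"
  obtains A l where "finite A" "A \<subseteq> T" "A \<noteq> {}" "\<And>t. t \<in> A \<Longrightarrow> l t \<in> carrier K"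
    "\<And>t. t \<in> A \<Longrightarrow> l t \<noteq> \<zero>" "(\<Oplus>\<^bsub>M\<^esub>t\<in>A. l t \<odot>\<^bsub>M\<^esub> v t) = \<zero>\<^bsub>M\<^esub>"
  using assms unfolding dependent_def Pi_iff by blast

lemma dependent_mono: "dependent T v \<Longrightarrow> T \<subseteq> T' \<Longrightarrow> dependent T' v"
  unfolding dependent_def by (meson order_trans)

text \<open>Gaussian elimination by induction on \<open>F\<close>: a pivot \<open>v p\<close> with
  nonzero coefficient at \<open>x\<close> clears \<open>x\<close> from all other vectors, and a
  relation among the reduced vectors is expanded back into one for \<open>v\<close>.\<close>

lemma dependent_in_finite_span:
  assumes "finite F" "F \<subseteq> carrier M" "infinite T" "v \<in> T \<rightarrow> lin_span K M F"
  shows "dependent T v"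
  using assms
proof (induction F arbitrary: T v rule: finite_induct)
  case empty
  then obtain p where p: "p \<in> T" by fastforce
  moreover have "lin_span K M {} = {\<zero>\<^bsub>M\<^esub>}" by (auto simp: lin_span_def)
  ultimately have "v p = \<zero>\<^bsub>M\<^esub>" using empty by auto
  then show ?case unfolding dependent_def using p
    by (intro exI[of _ "{p}"] exI[of _ "\<lambda>_. \<one>"]) simp
next
  case (insert x F)
  have x: "x \<in> carrier M" and F: "F \<subseteq> carrier M" using insert.prems by auto
  have "\<exists>c z. c \<in> carrier K \<and> z \<in> lin_span K M F \<and> v t = c \<odot>\<^bsub>M\<^esub> x \<oplus>\<^bsub>M\<^esub> z" if "t \<in> T" for t
    using lin_span_insertE[of F x "v t"] insert.hyps insert.prems that by (metis Pi_mem)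
  then obtain c z where cz: "\<And>t. t \<in> T \<Longrightarrow> c t \<in> carrier K" "\<And>t. t \<in> T \<Longrightarrow> z t \<in> lin_span K M F"
    "\<And>t. t \<in> T \<Longrightarrow> v t = c t \<odot>\<^bsub>M\<^esub> x \<oplus>\<^bsub>M\<^esub> z t" by metis
  have zM: "z t \<in> carrier M" if "t \<in> T" for t using lin_span_closed[OF insert.hyps(1) F] cz(2) that by auto
  have vM: "v t \<in> carrier M" if "t \<in> T" for t using zM cz(1,3) x that by auto
  show ?case
  proof (cases "\<forall>t\<in>T. c t = \<zero>")
    case True
    then have "v \<in> T \<rightarrow> lin_span K M F" using cz zM x by auto
    then show ?thesis using insert F by blast
  next
    case False
    then obtain p where p: "p \<in> T" "c p \<noteq> \<zero>" by blast
    define d where "d t = c t \<otimes> inv (c p)" for t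
    have ip: "inv (c p) \<in> carrier K" "inv (c p) \<otimes> c p = \<one>" using cz(1)[OF p(1)] p by (auto simp: field_Units)
    have d: "d t \<in> carrier K" "d t \<otimes> c p = c t" if "t \<in> T" for t
      using cz(1)[OF that] cz(1)[OF p(1)] ip by (auto simp: d_def m_assoc)
    define w where "w t = v t \<ominus>\<^bsub>M\<^esub> d t \<odot>\<^bsub>M\<^esub> v p" for t
    have "w t = z t \<ominus>\<^bsub>M\<^esub> d t \<odot>\<^bsub>M\<^esub> z p" if "t \<in> T" for t
    proof -
      define y where "y = c t \<odot>\<^bsub>M\<^esub> x"
      have y: "y \<in> carrier M" using cz(1)[OF that] x by (simp add: y_def)
      have q: "d t \<odot>\<^bsub>M\<^esub> z p \<in> carrier M" using d(1)[OF that] zM[OF p(1)] by simp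
      have "d t \<odot>\<^bsub>M\<^esub> v p = y \<oplus>\<^bsub>M\<^esub> d t \<odot>\<^bsub>M\<^esub> z p"
        using cz(1,3)[OF p(1)] d[OF that] x zM[OF p(1)]
        by (simp add: smult_r_distr y_def flip: smult_assoc1)
      then have "w t = (y \<oplus>\<^bsub>M\<^esub> z t) \<ominus>\<^bsub>M\<^esub> (y \<oplus>\<^bsub>M\<^esub> d t \<odot>\<^bsub>M\<^esub> z p)"
        using cz(3)[OF that] by (simp add: w_def y_def)
      also have "\<dots> = z t \<ominus>\<^bsub>M\<^esub> d t \<odot>\<^bsub>M\<^esub> z p"
        using y q zM[OF that] by (simp add: M.minus_eq M.minus_add M.a_assoc M.r_neg2
            M.a_lcomm[of "z t" "\<ominus>\<^bsub>M\<^esub> y" "\<ominus>\<^bsub>M\<^esub> (d t \<odot>\<^bsub>M\<^esub> z p)"])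
      finally show ?thesis .
    qed
    then have "w \<in> T - {p} \<rightarrow> lin_span K M F"
      using lin_span_diff_smult[OF insert.hyps(1) F] cz(2) d p by auto
    then have "dependent (T - {p}) w" using insert.IH[OF F, of "T - {p}" w] insert.prems by auto
    then obtain A l where A: "finite A" "A \<subseteq> T - {p}" "A \<noteq> {}" and l: "l \<in> A \<rightarrow> carrier K - {\<zero>}"
      and rel: "(\<Oplus>\<^bsub>M\<^esub>t\<in>A. l t \<odot>\<^bsub>M\<^esub> w t) = \<zero>\<^bsub>M\<^esub>" unfolding dependent_def by auto
    \<comment> \<open>The coefficient that \<open>v p\<close> collects in the expansion. Since
      \<open>dependent\<close> demands nonzero coefficients, \<open>p\<close> joins the relation
      only if \<open>m \<noteq> \<zero>\<close>.\<close>
    define m where "m = (\<Oplus>t\<in>A. \<ominus> (l t \<otimes> d t))"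
    have lK: "l t \<in> carrier K" "l t \<noteq> \<zero>" "d t \<in> carrier K" "v t \<in> carrier M" if "t \<in> A" for t
      using l A that d vM by auto
    have vp: "v p \<in> carrier M" using vM p by auto
    have m: "m \<in> carrier K" unfolding m_def using lK by auto
    have S: "(\<Oplus>\<^bsub>M\<^esub>t\<in>A. l t \<odot>\<^bsub>M\<^esub> v t) \<in> carrier M" using lK by auto
    have "\<zero>\<^bsub>M\<^esub> = (\<Oplus>\<^bsub>M\<^esub>t\<in>A. l t \<odot>\<^bsub>M\<^esub> v t \<oplus>\<^bsub>M\<^esub> (\<ominus> (l t \<otimes> d t)) \<odot>\<^bsub>M\<^esub> v p)"
      unfolding rel[symmetric] w_def
      using lK vp
      by (intro M.finsum_cong') (auto simp: M.minus_eq smult_r_distr smult_l_minus smult_r_minus smult_assoc1)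
    also have "\<dots> = (\<Oplus>\<^bsub>M\<^esub>t\<in>A. l t \<odot>\<^bsub>M\<^esub> v t) \<oplus>\<^bsub>M\<^esub> (\<Oplus>\<^bsub>M\<^esub>t\<in>A. (\<ominus> (l t \<otimes> d t)) \<odot>\<^bsub>M\<^esub> v p)"
      using lK vp by (intro M.add.finprod_multf) auto
    also have "(\<Oplus>\<^bsub>M\<^esub>t\<in>A. (\<ominus> (l t \<otimes> d t)) \<odot>\<^bsub>M\<^esub> v p) = m \<odot>\<^bsub>M\<^esub> v p"
      unfolding m_def using lK vp A by (intro finsum_smult_rdistr) auto
    finally have eq: "(\<Oplus>\<^bsub>M\<^esub>t\<in>A. l t \<odot>\<^bsub>M\<^esub> v t) \<oplus>\<^bsub>M\<^esub> m \<odot>\<^bsub>M\<^esub> v p = \<zero>\<^bsub>M\<^esub>" by simp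
    show ?thesis
    proof (cases "m = \<zero>")
      case True
      then have "(\<Oplus>\<^bsub>M\<^esub>t\<in>A. l t \<odot>\<^bsub>M\<^esub> v t) = \<zero>\<^bsub>M\<^esub>" using eq S vp by simp
      then show ?thesis unfolding dependent_def using A l by blast
    next
      case False
      have "(\<Oplus>\<^bsub>M\<^esub>t\<in>insert p A. (l(p := m)) t \<odot>\<^bsub>M\<^esub> v t) =
          (l(p := m)) p \<odot>\<^bsub>M\<^esub> v p \<oplus>\<^bsub>M\<^esub> (\<Oplus>\<^bsub>M\<^esub>t\<in>A. (l(p := m)) t \<odot>\<^bsub>M\<^esub> v t)"
        using A lK vp m by (intro M.finsum_insert) auto
      also have "(\<Oplus>\<^bsub>M\<^esub>t\<in>A. (l(p := m)) t \<odot>\<^bsub>M\<^esub> v t) = (\<Oplus>\<^bsub>M\<^esub>t\<in>A. l t \<odot>\<^bsub>M\<^esub> v t)"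
        using A lK by (intro M.finsum_cong') auto
      also have "(l(p := m)) p \<odot>\<^bsub>M\<^esub> v p \<oplus>\<^bsub>M\<^esub> \<dots> = \<zero>\<^bsub>M\<^esub>"
        using eq S vp m by (simp add: M.a_comm)
      finally show ?thesis unfolding dependent_def
        using A l m False p by (intro exI[of _ "insert p A"] exI[of _ "l(p := m)"]) (auto simp: Pi_iff split: if_splits)
    qed
  qed
qed

lemma lin_basis_finite_span:
  assumes "lin_basis K M S" "x \<in> carrier M"
  shows "\<exists>F\<in>Fpow S. x \<in> lin_span K M F"
proof -
  have "x \<in> lin_span K M S" using assms by (auto simp: lin_basis_def)
  then show ?thesis unfolding lin_span_def Fpow_def by blast
qed

text \<open>Pigeonhole on supports: each \<open>v t\<close> lies in the span of a finite
  \<open>F t \<subseteq> S\<close>, and there are too few finite subsets of \<open>S\<close> for all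
  fibres of \<open>F\<close> to be finite. An infinite fibre lies in one finite-dimensional
  span.\<close>

lemma dependent_of_card:
  assumes S: "lin_basis K M S" and less: "|S| <o |T|" and T: "infinite T" and v: "v \<in> T \<rightarrow> carrier M"
  shows "dependent T v"
proof -
  have SM: "S \<subseteq> carrier M" using S by (auto simp: lin_basis_def lin_indep_def)
  have "\<exists>F. F \<in> Fpow S \<and> v t \<in> lin_span K M F" if "t \<in> T" for t
    using lin_basis_finite_span[OF S, of "v t"] v that by auto
  then obtain F where F: "\<And>t. t \<in> T \<Longrightarrow> F t \<in> Fpow S" "\<And>t. t \<in> T \<Longrightarrow> v t \<in> lin_span K M (F t)"
    by metis
  have "\<exists>G\<in>Fpow S. infinite {t \<in> T. F t = G}"
  proof (rule ccontr)
    assume neg: "\<not> ?thesis"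
    have TU: "T = (\<Union>G\<in>Fpow S. {t \<in> T. F t = G})" using F(1) by auto
    show False
    proof (cases "finite S")
      case True
      then have "finite (Fpow S)" by (simp add: Fpow_def)
      then show False using neg T TU by (metis (no_types, lifting) finite_UN)
    next
      case False
      have "|\<Union>G\<in>Fpow S. {t \<in> T. F t = G}| \<le>o |S|"
      proof (intro card_of_UNION_ordLeq_infinite[OF False card_of_Fpow_ordLeq[OF False]] ballI)
        fix G assume "G \<in> Fpow S"
        then have "finite {t \<in> T. F t = G}" using neg by blast
        then show "|{t \<in> T. F t = G}| \<le>o |S|" using False finite_ordLeq_infinite by blast
      qed
      then show False using less TU not_ordLess_ordLeq by metis
    qed
  qed
  then obtain G where G: "G \<subseteq> S" "finite G" "infinite {t \<in> T. F t = G}" by (auto simp: Fpow_def)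
  have "dependent {t \<in> T. F t = G} v"
    using G SM F by (intro dependent_in_finite_span[of G]) auto
  then show ?thesis by (rule dependent_mono) auto
qed

lemma card_of_finite_span:
  assumes "infinite (carrier K)" "finite F" "F \<subseteq> carrier M"
  shows "|lin_span K M F| \<le>o |carrier K|"
  using assms(2,3)
proof (induction F rule: finite_induct)
  case empty
  have "lin_span K M {} = {\<zero>\<^bsub>M\<^esub>}" by (auto simp: lin_span_def)
  moreover have "|{\<zero>\<^bsub>M\<^esub>}| \<le>o |carrier K|" using assms by (intro card_of_singl_ordLeq) auto
  ultimately show ?case by (simp only:)
next
  case (insert x F)
  have "lin_span K M (insert x F) \<subseteq> (\<lambda>(c, z). c \<odot>\<^bsub>M\<^esub> x \<oplus>\<^bsub>M\<^esub> z) ` (carrier K \<times> lin_span K M F)"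
  proof
    fix y assume "y \<in> lin_span K M (insert x F)"
    then obtain c z where "c \<in> carrier K" "z \<in> lin_span K M F" "y = c \<odot>\<^bsub>M\<^esub> x \<oplus>\<^bsub>M\<^esub> z"
      by (rule lin_span_insertE[OF insert.hyps(1) insert.prems])
    then show "y \<in> (\<lambda>(c, z). c \<odot>\<^bsub>M\<^esub> x \<oplus>\<^bsub>M\<^esub> z) ` (carrier K \<times> lin_span K M F)"
      by (intro image_eqI[of _ _ "(c, z)"]) auto
  qed
  then have "|lin_span K M (insert x F)| \<le>o |carrier K \<times> lin_span K M F|" by (rule surj_imp_ordLeq)
  also have "|carrier K \<times> lin_span K M F| \<le>o |carrier K|"
    using card_of_Times_ordLeq_infinite_Field[of "|carrier K|" "carrier K" "lin_span K M F"] insert assms(1)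
    by (auto simp: Field_card_of card_of_card_order_on card_of_mono1)
  finally show ?case .
qed

text \<open>The space is the union of the spans of the finite subsets of a basis, each of size at
  most \<open>|carrier K|\<close>. The disjoint sum stands for the maximum of the two
  cardinals.\<close>

lemma card_of_carrier:
  assumes S: "lin_basis K M S" and inf: "infinite (carrier K)"
  shows "|carrier M| \<le>o |Sum_Type.Plus S (carrier K)|"
proof -
  have SM: "S \<subseteq> carrier M" using S by (auto simp: lin_basis_def lin_indep_def)
  have infp: "infinite (Sum_Type.Plus S (carrier K))" using inf by (simp add: finite_Plus_iff)
  have "|Fpow S| \<le>o |Sum_Type.Plus S (carrier K)|"
  proof (cases "finite S")
    case True
    then have "finite (Fpow S)" by (simp add: Fpow_def)
    then show ?thesis using infp finite_ordLeq_infinite by blast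
  next
    case False
    show ?thesis using card_of_Fpow_ordLeq[OF False] card_of_Plus1 ordLeq_transitive by blast
  qed
  moreover have "|lin_span K M F| \<le>o |Sum_Type.Plus S (carrier K)|" if "F \<in> Fpow S" for F
  proof -
    have "|lin_span K M F| \<le>o |carrier K|"
      using that SM by (intro card_of_finite_span[OF inf]) (auto simp: Fpow_def)
    then show ?thesis by (rule ordLeq_transitive[OF _ card_of_Plus2])
  qed
  ultimately have "|\<Union>F\<in>Fpow S. lin_span K M F| \<le>o |Sum_Type.Plus S (carrier K)|"
    by (intro card_of_UNION_ordLeq_infinite[OF infp]) auto
  moreover have "carrier M \<subseteq> (\<Union>F\<in>Fpow S. lin_span K M F)" using lin_basis_finite_span[OF S] by blast
  ultimately show ?thesis using ordLeq_transitive[OF card_of_mono1] by blast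
qed

end


section \<open>Kernels of linear maps on a power of the field\<close>

text \<open>Abstracts \<open>u \<mapsto> f (u a)\<close>. By \<open>g_cong\<close> only the values
  on \<open>I\<close> matter, so total functions can represent the elements of the power of the
  field. The aim is a kernel element with finitely many zeros on \<open>I\<close>.\<close>

locale evaluation = vspace +
  fixes I :: "'i set" and g :: "('i \<Rightarrow> 'a) \<Rightarrow> 'c"
  assumes inf: "infinite (carrier K)"
    and g_closed: "u \<in> I \<rightarrow> carrier K \<Longrightarrow> g u \<in> carrier M"
    and g_add: "u \<in> I \<rightarrow> carrier K \<Longrightarrow> w \<in> I \<rightarrow> carrier K \<Longrightarrow> g (\<lambda>i. u i \<oplus> w i) = g u \<oplus>\<^bsub>M\<^esub> g w"
    and g_smult: "c \<in> carrier K \<Longrightarrow> u \<in> I \<rightarrow> carrier K \<Longrightarrow> g (\<lambda>i. c \<otimes> u i) = c \<odot>\<^bsub>M\<^esub> g u"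
    and g_cong: "u \<in> I \<rightarrow> carrier K \<Longrightarrow> (\<And>i. i \<in> I \<Longrightarrow> u i = w i) \<Longrightarrow> g u = g w"
begin

lemma g_zero: "g (\<lambda>i. \<zero>) = \<zero>\<^bsub>M\<^esub>"
proof -
  have "g (\<lambda>i. \<zero> \<otimes> \<zero>) = \<zero> \<odot>\<^bsub>M\<^esub> g (\<lambda>i. \<zero>)" by (rule g_smult) auto
  then show ?thesis using g_closed[of "\<lambda>i. \<zero>"] by simp
qed

lemma g_diff:
  assumes "u \<in> I \<rightarrow> carrier K" "w \<in> I \<rightarrow> carrier K"
  shows "g (\<lambda>i. u i \<ominus> w i) = g u \<ominus>\<^bsub>M\<^esub> g w"
proof -
  have "g (\<lambda>i. u i \<ominus> w i) = g (\<lambda>i. u i \<oplus> \<ominus> \<one> \<otimes> w i)"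
    using assms by (intro g_cong) (auto simp: l_minus R.minus_eq Pi_iff)
  also have "\<dots> = g u \<oplus>\<^bsub>M\<^esub> g (\<lambda>i. \<ominus> \<one> \<otimes> w i)" using assms by (intro g_add) auto
  also have "g (\<lambda>i. \<ominus> \<one> \<otimes> w i) = \<ominus>\<^bsub>M\<^esub> g w"
    using assms g_closed by (simp add: g_smult smult_l_minus)
  finally show ?thesis by (simp add: M.minus_eq)
qed

lemma g_finsum:
  assumes "finite A" "l \<in> A \<rightarrow> carrier K" "\<And>t. t \<in> A \<Longrightarrow> w t \<in> I \<rightarrow> carrier K"
  shows "g (\<lambda>i. \<Oplus>t\<in>A. l t \<otimes> w t i) = (\<Oplus>\<^bsub>M\<^esub>t\<in>A. l t \<odot>\<^bsub>M\<^esub> g (w t))"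
  using assms
proof (induction A rule: finite_induct)
  case empty
  then show ?case by (simp add: g_zero)
next
  case (insert a A)
  have w: "w t i \<in> carrier K" if "t \<in> insert a A" "i \<in> I" for t i using insert.prems that by auto
  have l: "l t \<in> carrier K" if "t \<in> insert a A" for t using insert.prems that by auto
  have "g (\<lambda>i. \<Oplus>t\<in>insert a A. l t \<otimes> w t i) = g (\<lambda>i. l a \<otimes> w a i \<oplus> (\<Oplus>t\<in>A. l t \<otimes> w t i))"
    using insert.hyps w l by (intro g_cong) (auto intro!: R.finsum_insert R.finsum_closed)
  also have "\<dots> = g (\<lambda>i. l a \<otimes> w a i) \<oplus>\<^bsub>M\<^esub> g (\<lambda>i. \<Oplus>t\<in>A. l t \<otimes> w t i)"
    using w l by (intro g_add) (auto intro!: R.finsum_closed)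
  also have "\<dots> = l a \<odot>\<^bsub>M\<^esub> g (w a) \<oplus>\<^bsub>M\<^esub> (\<Oplus>\<^bsub>M\<^esub>t\<in>A. l t \<odot>\<^bsub>M\<^esub> g (w t))"
    using insert w l by (simp add: g_smult Pi_iff)
  also have "\<dots> = (\<Oplus>\<^bsub>M\<^esub>t\<in>insert a A. l t \<odot>\<^bsub>M\<^esub> g (w t))"
    using insert w l g_closed by (intro M.finsum_insert[symmetric]) (auto simp: Pi_iff)
  finally show ?case .
qed

text \<open>The witness is a linear combination of the functions \<open>i \<mapsto> 1 / (t - c i)\<close>, \<open>t \<in> T\<close>.\<close>

lemma kernel_fibrewise:
  assumes P: "P \<subseteq> I" and c: "c \<in> P \<rightarrow> carrier K" and T: "T \<subseteq> carrier K"
    and dep: "\<And>v. v \<in> T \<rightarrow> carrier M \<Longrightarrow> dependent T v"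
  obtains Z u where "finite Z" "u \<in> I \<rightarrow> carrier K" "\<And>i. i \<in> I - P \<Longrightarrow> u i = \<zero>"
    "\<And>i. i \<in> P \<Longrightarrow> u i = \<zero> \<Longrightarrow> c i \<in> Z" "g u = \<zero>\<^bsub>M\<^esub>"
proof -
  \<comment> \<open>Zero replaces the undefined value at the pole \<open>c i = t\<close>.\<close>
  define w where "w t i = (if i \<in> P \<and> c i \<noteq> t then inv (t \<ominus> c i) else \<zero>)" for t i
  have inv: "inv (t \<ominus> z) \<in> carrier K" if "t \<in> carrier K" "z \<in> carrier K" "z \<noteq> t" for t z
    using that minus_eq_zero_iff[of t z] by (auto simp: field_Units)
  have w: "w t \<in> I \<rightarrow> carrier K" if "t \<in> T" for t
    using c T that by (auto simp: w_def intro!: inv)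
  have "dependent T (\<lambda>t. g (w t))" by (rule dep) (use w g_closed in blast)
  then obtain A l where A: "finite A" "A \<subseteq> T" "A \<noteq> {}" and l: "l \<in> A \<rightarrow> carrier K - {\<zero>}"
    and rel: "(\<Oplus>\<^bsub>M\<^esub>t\<in>A. l t \<odot>\<^bsub>M\<^esub> g (w t)) = \<zero>\<^bsub>M\<^esub>" unfolding dependent_def by auto
  define u where "u i = (\<Oplus>t\<in>A. l t \<otimes> w t i)" for i
  \<comment> \<open>The poles in \<open>A\<close>, where the default in \<open>w\<close> spoils the
    formula, together with the zeros of the rational function itself.\<close>
  define Z where "Z = A \<union> {z \<in> carrier K - A. \<zero> \<oplus> (\<Oplus>t\<in>A. l t \<otimes> inv (t \<ominus> z)) = \<zero>}"
  have lK: "l t \<in> carrier K" if "t \<in> A" for t using l that by auto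
  show thesis
  proof
    show "finite Z" unfolding Z_def using A l T finite_partial_fraction_zeros[of A \<zero> l] by auto
    show "u \<in> I \<rightarrow> carrier K" unfolding u_def using w A(2) lK by (fastforce intro!: R.finsum_closed)
    show "u i = \<zero>" if "i \<in> I - P" for i
    proof -
      have "u i = (\<Oplus>t\<in>A. \<zero>)" unfolding u_def using that lK by (intro R.finsum_cong') (auto simp: w_def)
      then show ?thesis by simp
    qed
    show "c i \<in> Z" if i: "i \<in> P" "u i = \<zero>" for i
    proof (rule ccontr)
      assume nZ: "c i \<notin> Z"
      have ci: "c i \<in> carrier K" "c i \<notin> A" using c i nZ by (auto simp: Z_def)
      have cl: "l t \<otimes> inv (t \<ominus> c i) \<in> carrier K" if "t \<in> A" for t
        using inv[of t "c i"] ci that lK[OF that] A(2) T by auto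
      have eq: "u i = (\<Oplus>t\<in>A. l t \<otimes> inv (t \<ominus> c i))"
        unfolding u_def using i ci cl by (intro R.finsum_cong') (auto simp: w_def)
      have "\<zero> \<oplus> (\<Oplus>t\<in>A. l t \<otimes> inv (t \<ominus> c i)) = \<zero>" unfolding eq[symmetric] i(2) by simp
      then show False using nZ ci by (auto simp: Z_def)
    qed
    have "g u = (\<Oplus>\<^bsub>M\<^esub>t\<in>A. l t \<odot>\<^bsub>M\<^esub> g (w t))"
      unfolding u_def using A lK w by (intro g_finsum) auto
    then show "g u = \<zero>\<^bsub>M\<^esub>" using rel by simp
  qed
qed

text \<open>With \<open>c\<close> injective on \<open>I\<close>, the finitely many values in
  \<open>Z\<close> belong to finitely many indices. Dependence holds because
  \<open>carrier K\<close> outnumbers a basis.\<close>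

lemma kernel_of_card_le:
  assumes S: "lin_basis K M S" "|S| <o |carrier K|" and I: "|I| \<le>o |carrier K|"
  obtains u where "u \<in> I \<rightarrow> carrier K" "finite {i \<in> I. u i = \<zero>}" "g u = \<zero>\<^bsub>M\<^esub>"
proof -
  obtain c where c: "inj_on c I" "c ` I \<subseteq> carrier K" using I card_of_ordLeq by metis
  obtain Z u where Z: "finite Z" and u: "u \<in> I \<rightarrow> carrier K" "\<And>i. i \<in> I \<Longrightarrow> u i = \<zero> \<Longrightarrow> c i \<in> Z" "g u = \<zero>\<^bsub>M\<^esub>"
    using kernel_fibrewise[OF order_refl _ order_refl dependent_of_card[OF S inf]] c
    by (metis image_subset_iff_funcset)
  have "finite (c -` Z \<inter> I)" using Z c(1) by (rule finite_vimage_IntI)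
  then have "finite {i \<in> I. u i = \<zero>}" by (rule finite_subset[rotated]) (use u in auto)
  then show thesis using that u by blast
qed

text \<open>Pigeonhole: the \<open>2\<^sup>\<omega>\<close> functions \<open>i \<mapsto> p (X \<inter> {..<e i})\<close> agree pairwise only finitely often.\<close>

lemma kernel_of_countable:
  assumes M: "|carrier M| <o |UNIV :: nat set set|" and I: "|I| \<le>o |UNIV :: nat set|"
  obtains u where "u \<in> I \<rightarrow> carrier K" "finite {i \<in> I. u i = \<zero>}" "g u = \<zero>\<^bsub>M\<^esub>"
proof -
  obtain e :: "'i \<Rightarrow> nat" where e: "inj_on e I" using I card_of_ordLeq by metis
  have "|Fpow (UNIV :: nat set)| \<le>o |UNIV :: nat set|" by (rule card_of_Fpow_ordLeq) simp
  also have "|UNIV :: nat set| \<le>o |carrier K|" using inf infinite_iff_card_of_nat by blast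
  finally obtain p where p: "inj_on p (Fpow (UNIV :: nat set))" "p ` Fpow (UNIV :: nat set) \<subseteq> carrier K"
    using card_of_ordLeq by metis
  define u where "u X i = p (X \<inter> {..<e i})" for X i
  have fp: "X \<inter> {..<n} \<in> Fpow UNIV" for X and n :: nat by (auto simp: Fpow_def)
  have u: "u X \<in> I \<rightarrow> carrier K" for X using p(2) fp by (auto simp: u_def)
  have "\<not> inj (\<lambda>X. g (u X))"
  proof
    assume "inj (\<lambda>X. g (u X))"
    then have "|UNIV :: nat set set| \<le>o |carrier M|" by (rule card_of_ordLeqI) (simp add: g_closed u)
    then show False using M not_ordLess_ordLeq by blast
  qed
  then obtain X Y where XY: "X \<noteq> Y" "g (u X) = g (u Y)" by (auto simp: inj_on_def)
  then obtain m where m: "m \<in> X \<longleftrightarrow> m \<notin> Y" by blast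
  show thesis
  proof
    show "(\<lambda>i. u X i \<ominus> u Y i) \<in> I \<rightarrow> carrier K" using u by (simp add: Pi_iff)
    show "g (\<lambda>i. u X i \<ominus> u Y i) = \<zero>\<^bsub>M\<^esub>"
      using g_diff[OF u u] XY g_closed[OF u] by (simp add: M.minus_eq M.r_neg)
    \<comment> \<open>If \<open>m < e i\<close>, the truncations of \<open>X\<close> and
      \<open>Y\<close> at \<open>e i\<close> differ at \<open>m\<close>, and the injective
      \<open>p\<close> separates them.\<close>
    have "e i \<le> m" if "i \<in> I" "u X i \<ominus> u Y i = \<zero>" for i
    proof -
      have "u X i = u Y i" using that u[of X] u[of Y] minus_eq_zero_iff[of "u X i" "u Y i"] by auto
      then have "X \<inter> {..<e i} = Y \<inter> {..<e i}" using p(1) fp unfolding u_def inj_on_def by blast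
      then show ?thesis using m by (metis Int_iff lessThan_iff not_le)
    qed
    then have "{i \<in> I. u X i \<ominus> u Y i = \<zero>} \<subseteq> e -` {..m} \<inter> I" by auto
    then show "finite {i \<in> I. u X i \<ominus> u Y i = \<zero>}"
      using finite_vimage_IntI[OF _ e, of "{..m}"] finite_subset by blast
  qed
qed

text \<open>If the field has at least continuum many elements, \<open>kernel_of_card_le\<close>
  applies. Otherwise dimension and field are both below the continuum, hence so is
  \<open>carrier M\<close>, and the pigeonhole argument applies.\<close>

lemma kernel_of_continuum:
  assumes S: "lin_basis K M S" "|S| <o ctwo ^c natLeq" and I: "|I| =o natLeq"
  obtains u where "u \<in> I \<rightarrow> carrier K" "finite {i \<in> I. u i = \<zero>}" "g u = \<zero>\<^bsub>M\<^esub>"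
proof -
  have pow: "|UNIV :: nat set set| =o ctwo ^c natLeq"
    using card_of_Pow_Func[of "UNIV :: nat set"] by (simp add: ctwo_def cexp_def Field_natLeq Field_card_of)
  have less: "|S| <o |UNIV :: nat set set|" using S(2) pow ordIso_symmetric ordLess_ordIso_trans by blast
  have In: "|I| \<le>o |UNIV :: nat set|"
    using I card_of_nat ordIso_symmetric ordIso_transitive ordIso_imp_ordLeq by metis
  show thesis
  proof (cases "|UNIV :: nat set set| \<le>o |carrier K|")
    case True
    have "|S| <o |carrier K|" using less True ordLess_ordLeq_trans by blast
    moreover have "|I| \<le>o |carrier K|" using In inf infinite_iff_card_of_nat ordLeq_transitive by blast
    ultimately show thesis using kernel_of_card_le[OF S(1)] that by blast
  next
    case False
    then have "|carrier K| <o |UNIV :: nat set set|"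
      using not_ordLeq_iff_ordLess[OF card_of_Well_order card_of_Well_order] by blast
    moreover have "infinite (UNIV :: nat set set)" by (simp add: Finite_Set.finite_set)
    ultimately have "|Sum_Type.Plus S (carrier K)| <o |UNIV :: nat set set|"
      using less card_of_Plus_ordLess_infinite by blast
    then have "|carrier M| <o |UNIV :: nat set set|"
      using card_of_carrier[OF S(1) inf] ordLeq_ordLess_trans by blast
    then show thesis using kernel_of_countable[OF _ In] that by blast
  qed
qed

end


section \<open>Finite-dimensional targets and measurable cardinals\<close>

text \<open>\<open>D\<close> is a least index set of a family in \<open>U\<close> whose intersection is not in \<open>U\<close>; its
  ultrafilter is the image of \<open>U\<close> under a map sending a point to the index of a member missing it.\<close>

lemma ultrafilter_imp_measurable_cardinal:
  fixes P :: "'i set"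
  assumes U: "ultrafilter_on P U" "nonprincipal_on P U"
    and complete: "\<And>F. F \<subseteq> U \<Longrightarrow> F \<noteq> {} \<Longrightarrow> |F| \<le>o |C| \<Longrightarrow> \<Inter>F \<in> U"
  shows "\<exists>D\<subseteq>P. measurable_cardinal |D| \<and> |C| <o |D|"
proof -
  have sub: "U \<subseteq> Pow P" and PU: "P \<in> U" and eU: "{} \<notin> U"
    and up: "\<And>X Y. X \<in> U \<Longrightarrow> X \<subseteq> Y \<Longrightarrow> Y \<subseteq> P \<Longrightarrow> Y \<in> U"
    and int: "\<And>X Y. X \<in> U \<Longrightarrow> Y \<in> U \<Longrightarrow> X \<inter> Y \<in> U"
    and ultra: "\<And>X. X \<subseteq> P \<Longrightarrow> X \<in> U \<or> P - X \<in> U"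
    using U(1) unfolding ultrafilter_on_def by blast+
  \<comment> \<open>Index sets are taken inside \<open>P\<close>, so that all of them have the same
    type and one of least cardinality exists. Intersecting with \<open>P\<close> gives the empty
    family the value \<open>P\<close>.\<close>
  define bad where "bad D \<longleftrightarrow> D \<subseteq> P \<and> (\<exists>X. X \<in> D \<rightarrow> U \<and> P \<inter> (\<Inter>d\<in>D. X d) \<notin> U)" for D
  \<comment> \<open>The complements of points have empty intersection, and they lie in
    \<open>U\<close> because a singleton in \<open>U\<close> would make it principal.\<close>
  have "bad P" unfolding bad_def
  proof (intro conjI exI[of _ "\<lambda>d. P - {d}"])
    have "{d} \<notin> U" if "d \<in> P" for d
    proof
      assume d: "{d} \<in> U"
      have "U = {X. X \<subseteq> P \<and> d \<in> X}"
      proof (intro equalityI subsetI)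
        fix X assume X: "X \<in> U"
        then have "X \<inter> {d} \<noteq> {}" using int[OF X d] eU by metis
        then show "X \<in> {X. X \<subseteq> P \<and> d \<in> X}" using X sub by auto
      next
        fix X assume "X \<in> {X. X \<subseteq> P \<and> d \<in> X}"
        then show "X \<in> U" using up[OF d, of X] by auto
      qed
      then show False using U(2) that unfolding nonprincipal_on_def by blast
    qed
    then show "(\<lambda>d. P - {d}) \<in> P \<rightarrow> U" using ultra by blast
    have "P \<inter> (\<Inter>d\<in>P. P - {d}) = {}" by auto
    then show "P \<inter> (\<Inter>d\<in>P. P - {d}) \<notin> U" using eU by simp
  qed simp
  moreover have "wf (inv_image ordLess (\<lambda>D :: 'i set. |D| ))" by (intro wf_inv_image wf_ordLess)
  ultimately obtain D where D: "bad D" and min: "\<And>D'. |D'| <o |D| \<Longrightarrow> \<not> bad D'"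
    using wfE_min[of "inv_image ordLess (\<lambda>D :: 'i set. |D| )" P "Collect bad"] by auto
  obtain X where DP: "D \<subseteq> P" and X: "X \<in> D \<rightarrow> U" "P \<inter> (\<Inter>d\<in>D. X d) \<notin> U"
    using D unfolding bad_def by blast
  \<comment> \<open>The complement of the bad intersection lies in \<open>U\<close>, and each of its
    points is missed by some \<open>X d\<close>, so \<open>\<phi>\<close> can be chosen on
    it.\<close>
  define Q where "Q = P - (P \<inter> (\<Inter>d\<in>D. X d))"
  have QU: "Q \<in> U" using ultra[of "P \<inter> (\<Inter>d\<in>D. X d)"] X(2) by (auto simp: Q_def)
  have QP: "Q \<subseteq> P" by (auto simp: Q_def)
  have "\<forall>i\<in>Q. \<exists>d\<in>D. i \<notin> X d" by (auto simp: Q_def)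
  then obtain \<phi> where \<phi>: "\<And>i. i \<in> Q \<Longrightarrow> \<phi> i \<in> D" "\<And>i. i \<in> Q \<Longrightarrow> i \<notin> X (\<phi> i)" by metis
  define pre where "pre G = {i \<in> Q. \<phi> i \<in> G}" for G
  define U' where "U' = {G. G \<subseteq> D \<and> pre G \<in> U}"
  have preP: "pre G \<subseteq> P" for G using QP by (auto simp: pre_def)
  have "ultrafilter_on D U'"
    unfolding ultrafilter_on_def
  proof (intro conjI ballI allI impI)
    show "U' \<subseteq> Pow D" by (auto simp: U'_def)
    have "pre D = Q" using \<phi>(1) by (auto simp: pre_def)
    then show "D \<in> U'" using QU by (auto simp: U'_def)
    show "{} \<notin> U'" using eU by (auto simp: U'_def pre_def)
    show "G' \<in> U'" if "G \<in> U'" "G \<subseteq> G' \<and> G' \<subseteq> D" for G G'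
      using that up[of "pre G" "pre G'"] preP by (auto simp: U'_def pre_def subset_iff)
    show "G \<inter> G' \<in> U'" if "G \<in> U'" "G' \<in> U'" for G G'
    proof -
      have "pre (G \<inter> G') = pre G \<inter> pre G'" by (auto simp: pre_def)
      then show ?thesis using that int by (auto simp: U'_def)
    qed
    show "G \<in> U' \<or> D - G \<in> U'" if "G \<subseteq> D" for G
    proof -
      have "pre (D - G) = Q \<inter> (P - pre G)" using \<phi>(1) QP by (auto simp: pre_def)
      then show ?thesis using that ultra[OF preP, of G] int[OF QU] by (auto simp: U'_def)
    qed
  qed
  moreover have "nonprincipal_on D U'"
    unfolding nonprincipal_on_def
  proof
    assume "\<exists>d\<in>D. U' = {G. G \<subseteq> D \<and> d \<in> G}"
    then obtain d where d: "d \<in> D" "U' = {G. G \<subseteq> D \<and> d \<in> G}" by blast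
    then have "{d} \<in> U'" by auto
    then have "pre {d} \<inter> X d \<in> U" using X(1) d(1) int by (auto simp: U'_def)
    moreover have "pre {d} \<inter> X d = {}" using \<phi>(2) by (auto simp: pre_def)
    ultimately show False using eU by simp
  qed
  moreover have "complete_for |D| U'"
    unfolding complete_for_def
  proof (intro allI impI)
    fix F assume F: "F \<subseteq> U' \<and> F \<noteq> {} \<and> |F| <o |D|"
    \<comment> \<open>\<open>h\<close> re-indexes \<open>F\<close> by a subset of \<open>D\<close>
      smaller than \<open>D\<close>; by minimality that subset is not bad.\<close>
    then obtain h where h: "inj_on h F" "h ` F \<subseteq> D" using ordLess_imp_ordLeq card_of_ordLeq by metis
    have "|h ` F| <o |D|" using card_of_image F by (blast intro: ordLeq_ordLess_trans)
    then have "\<not> bad (h ` F)" by (rule min)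
    moreover have "(\<lambda>d. pre (inv_into F h d)) \<in> h ` F \<rightarrow> U"
      using F h by (auto simp: U'_def)
    ultimately have "P \<inter> (\<Inter>d\<in>h ` F. pre (inv_into F h d)) \<in> U" using h DP unfolding bad_def by blast
    moreover have "P \<inter> (\<Inter>d\<in>h ` F. pre (inv_into F h d)) = pre (\<Inter>F)"
      using F h QP by (auto simp: pre_def)
    moreover have "\<Inter>F \<subseteq> D" using F unfolding U'_def by blast
    ultimately show "\<Inter>F \<in> U'" by (simp add: U'_def)
  qed
  ultimately have "measurable_cardinal |D|"
    unfolding measurable_cardinal_def Field_card_of using card_of_card_order_on by blast
  moreover have "|C| <o |D|"
  proof (rule ccontr)
    assume "\<not> |C| <o |D|"
    then have "|D| \<le>o |C|" using not_ordLess_iff_ordLeq[OF card_of_Well_order card_of_Well_order] by blast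
    then have "|X ` D| \<le>o |C|" by (rule ordLeq_transitive[OF card_of_image])
    moreover have "D \<noteq> {}" using X(2) PU by auto
    ultimately have "\<Inter>(X ` D) \<in> U" using X(1) by (intro complete) auto
    then show False using X(2) int[OF PU] by simp
  qed
  ultimately show ?thesis using DP by blast
qed

section \<open>Values of functions with bounded or prescribed support\<close>

context evaluation
begin

definition vals :: "'i set \<Rightarrow> 'c set"
  where "vals S = {g u | u. u \<in> I \<rightarrow> carrier K \<and> (\<forall>i\<in>I - S. u i = \<zero>)}"

definition full :: "'i set \<Rightarrow> 'c set"
  where "full S = {g u | u. u \<in> I \<rightarrow> carrier K \<and> (\<forall>i\<in>S. u i \<noteq> \<zero>) \<and> (\<forall>i\<in>I - S. u i = \<zero>)}"

lemma full_subset_vals: "full S \<subseteq> vals S"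
  unfolding full_def vals_def by blast

lemma vals_closed: "vals S \<subseteq> carrier M"
  unfolding vals_def using g_closed by blast

lemma full_closed: "full S \<subseteq> carrier M"
  using full_subset_vals vals_closed by blast

lemma vals_mono: "S \<subseteq> T \<Longrightarrow> vals S \<subseteq> vals T"
  unfolding vals_def by blast

lemma vals_empty: "vals {} = {\<zero>\<^bsub>M\<^esub>}"
proof -
  have "g u = \<zero>\<^bsub>M\<^esub>" if "u \<in> I \<rightarrow> carrier K" "\<forall>i\<in>I. u i = \<zero>" for u
    using g_cong[OF that(1), of "\<lambda>_. \<zero>"] that g_zero by simp
  moreover have "\<zero>\<^bsub>M\<^esub> \<in> vals {}"
    unfolding vals_def using g_zero by (auto intro!: exI[of _ "\<lambda>_. \<zero>"])
  ultimately show ?thesis unfolding vals_def by auto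
qed

lemma full_nonempty: "full S \<noteq> {}"
proof -
  have "g (\<lambda>i. if i \<in> S then \<one> else \<zero>) \<in> full S" unfolding full_def by auto
  then show ?thesis by blast
qed

lemma full_empty: "full {} = {\<zero>\<^bsub>M\<^esub>}"
  using full_nonempty[of "{}"] full_subset_vals[of "{}"] vals_empty subset_singletonD by metis

lemma full_add:
  assumes "S \<inter> T = {}" "S \<subseteq> I" "T \<subseteq> I" "x \<in> full S" "y \<in> full T"
  shows "x \<oplus>\<^bsub>M\<^esub> y \<in> full (S \<union> T)"
proof -
  obtain u where u: "u \<in> I \<rightarrow> carrier K" "\<And>i. i \<in> S \<Longrightarrow> u i \<noteq> \<zero>" "\<And>i. i \<in> I - S \<Longrightarrow> u i = \<zero>" "x = g u"
    using assms(4) unfolding full_def by blast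
  obtain w where w: "w \<in> I \<rightarrow> carrier K" "\<And>i. i \<in> T \<Longrightarrow> w i \<noteq> \<zero>" "\<And>i. i \<in> I - T \<Longrightarrow> w i = \<zero>" "y = g w"
    using assms(5) unfolding full_def by blast
  have "u i \<oplus> w i \<noteq> \<zero>" if "i \<in> S \<union> T" for i
  proof (cases "i \<in> S")
    case True
    then have "i \<in> I" "w i = \<zero>" using assms(1,2) w(3) by auto
    then show ?thesis using u(1,2) True by (auto simp: Pi_iff)
  next
    case False
    then have "i \<in> T" "i \<in> I" "u i = \<zero>" using that assms(3) u(3) by auto
    then show ?thesis using w(1,2) by (auto simp: Pi_iff)
  qed
  moreover have "u i \<oplus> w i = \<zero>" if "i \<in> I - (S \<union> T)" for i using that u(3) w(3) by simp
  moreover have "(\<lambda>i. u i \<oplus> w i) \<in> I \<rightarrow> carrier K" using u(1) w(1) by auto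
  moreover have "x \<oplus>\<^bsub>M\<^esub> y = g (\<lambda>i. u i \<oplus> w i)" using g_add u w by simp
  ultimately show ?thesis unfolding full_def by blast
qed

lemma full_smult:
  assumes "c \<in> carrier K" "c \<noteq> \<zero>" "S \<subseteq> I" "x \<in> full S"
  shows "c \<odot>\<^bsub>M\<^esub> x \<in> full S"
proof -
  obtain u where u: "u \<in> I \<rightarrow> carrier K" "\<And>i. i \<in> S \<Longrightarrow> u i \<noteq> \<zero>" "\<And>i. i \<in> I - S \<Longrightarrow> u i = \<zero>" "x = g u"
    using assms(4) unfolding full_def by blast
  have "c \<otimes> u i \<noteq> \<zero>" if "i \<in> S" for i
    using that u(1,2) assms(1-3) integral[of c "u i"] by (auto simp: Pi_iff)
  moreover have "c \<otimes> u i = \<zero>" if "i \<in> I - S" for i using that u(3) assms(1) by simp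
  moreover have "(\<lambda>i. c \<otimes> u i) \<in> I \<rightarrow> carrier K" using u(1) assms(1) by auto
  moreover have "c \<odot>\<^bsub>M\<^esub> x = g (\<lambda>i. c \<otimes> u i)" using g_smult u assms(1) by simp
  ultimately show ?thesis unfolding full_def by blast
qed

lemma full_finsum:
  assumes "finite A" "\<And>n. n \<in> A \<Longrightarrow> S n \<subseteq> I" "\<And>m n. m \<in> A \<Longrightarrow> n \<in> A \<Longrightarrow> m \<noteq> n \<Longrightarrow> S m \<inter> S n = {}"
    "\<And>n. n \<in> A \<Longrightarrow> x n \<in> full (S n)"
  shows "(\<Oplus>\<^bsub>M\<^esub>n\<in>A. x n) \<in> full (\<Union>n\<in>A. S n)"
  using assms
proof (induction A rule: finite_induct)
  case empty
  then show ?case by (simp add: full_empty)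
next
  case (insert a A)
  have "x n \<in> carrier M" if "n \<in> insert a A" for n using insert.prems(3)[OF that] full_closed by blast
  then have "(\<Oplus>\<^bsub>M\<^esub>n\<in>insert a A. x n) = x a \<oplus>\<^bsub>M\<^esub> (\<Oplus>\<^bsub>M\<^esub>n\<in>A. x n)"
    using insert.hyps by (intro M.finsum_insert) auto
  moreover have "(\<Oplus>\<^bsub>M\<^esub>n\<in>A. x n) \<in> full (\<Union>n\<in>A. S n)"
    using insert.prems by (intro insert.IH) auto
  moreover have "S a \<inter> (\<Union>n\<in>A. S n) = {}" using insert.prems(2)[of a] insert.hyps(2) by fastforce
  moreover have "S a \<subseteq> I" "(\<Union>n\<in>A. S n) \<subseteq> I" using insert.prems(1) by auto
  ultimately show ?case using full_add[of "S a" "\<Union>n\<in>A. S n" "x a" "\<Oplus>\<^bsub>M\<^esub>n\<in>A. x n"] insert.prems(3)[of a]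
    by simp
qed

text \<open>Together with \<open>vals_mono\<close> this makes the sets supporting only values in
  \<open>Y\<close> an ideal; its dual filter on a suitable \<open>P\<close> will be the
  ultrafilter.\<close>

lemma vals_Un_subset:
  assumes Y: "submodule Y K M" and S: "vals S \<subseteq> Y" and T: "vals T \<subseteq> Y"
  shows "vals (S \<union> T) \<subseteq> Y"
proof
  fix x assume "x \<in> vals (S \<union> T)"
  then obtain u where u: "u \<in> I \<rightarrow> carrier K" "\<And>i. i \<in> I - (S \<union> T) \<Longrightarrow> u i = \<zero>" "x = g u"
    unfolding vals_def by blast
  define v w where "v i = (if i \<in> S then u i else \<zero>)" and "w i = (if i \<in> S then \<zero> else u i)" for i
  have vw: "v \<in> I \<rightarrow> carrier K" "w \<in> I \<rightarrow> carrier K" using u(1) by (auto simp: v_def w_def)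
  have "g u = g (\<lambda>i. v i \<oplus> w i)" using u(1) by (intro g_cong) (auto simp: v_def w_def Pi_iff)
  then have "x = g v \<oplus>\<^bsub>M\<^esub> g w" using g_add vw u(3) by simp
  moreover have "g v \<in> vals S" unfolding vals_def using vw by (auto simp: v_def)
  moreover have "g w \<in> vals T" unfolding vals_def using vw u(2) by (auto simp: w_def)
  ultimately show "x \<in> Y" using submoduleE(5)[OF Y] S T by auto
qed

lemma vals_UN_subset:
  assumes "submodule Y K M" "finite A" "\<And>n. n \<in> A \<Longrightarrow> vals (S n) \<subseteq> Y"
  shows "vals (\<Union>n\<in>A. S n) \<subseteq> Y"
  using assms(2,3)
proof (induction A rule: finite_induct)
  case empty
  then show ?case using subgroup.one_closed[OF submodule.axioms(1)[OF assms(1)]] by (simp add: vals_empty)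
next
  case (insert a A)
  then show ?case using vals_Un_subset[OF assms(1)] by simp
qed

text \<open>Over an infinite field every value is a sum of two values with the same full support.\<close>

lemma full_not_subset:
  assumes Y: "submodule Y K M" and S: "S \<subseteq> I" "\<not> vals S \<subseteq> Y"
  shows "\<exists>x\<in>full S. x \<notin> Y"
proof (rule ccontr)
  assume neg: "\<not> ?thesis"
  obtain u where u: "u \<in> I \<rightarrow> carrier K" "\<And>i. i \<in> I - S \<Longrightarrow> u i = \<zero>" "g u \<notin> Y"
    using S(2) unfolding vals_def by blast
  \<comment> \<open>Avoiding both \<open>\<zero>\<close> and \<open>u i\<close> makes the summands
    \<open>a i\<close> and \<open>u i \<ominus> a i\<close> nonzero on \<open>S\<close>.\<close>
  have "\<exists>a. a \<in> carrier K \<and> a \<noteq> \<zero> \<and> a \<noteq> u i" for i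
  proof -
    have "infinite (carrier K - {\<zero>, u i})" using inf by simp
    then have "carrier K - {\<zero>, u i} \<noteq> {}" by (metis finite.emptyI)
    then show ?thesis by blast
  qed
  then obtain a where a: "\<And>i. a i \<in> carrier K" "\<And>i. a i \<noteq> \<zero>" "\<And>i. a i \<noteq> u i" by metis
  define v w where "v i = (if i \<in> S then a i else \<zero>)" and "w i = (if i \<in> S then u i \<ominus> a i else \<zero>)" for i
  have uK: "u i \<in> carrier K" if "i \<in> I" for i using u that by auto
  have vw: "v \<in> I \<rightarrow> carrier K" "w \<in> I \<rightarrow> carrier K" using uK a by (auto simp: v_def w_def)
  have "v i \<oplus> w i = u i" if "i \<in> I" for i
  proof -
    have "a i \<oplus> (u i \<ominus> a i) = u i" using a(1)[of i] uK[OF that] by algebra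
    then show ?thesis using that u(2)[of i] by (auto simp: v_def w_def)
  qed
  then have "g u = g (\<lambda>i. v i \<oplus> w i)" using u(1) by (intro g_cong) auto
  then have eq: "g u = g v \<oplus>\<^bsub>M\<^esub> g w" using g_add vw by simp
  have "g v \<in> full S" unfolding full_def using vw a(2) by (auto simp: v_def)
  moreover have "u i \<ominus> a i \<noteq> \<zero>" if "i \<in> S" for i
    using that a(1,3)[of i] uK[of i] S(1) minus_eq_zero_iff[of "u i" "a i"] by auto
  then have "g w \<in> full S" unfolding full_def using vw by (auto simp: w_def)
  ultimately have "g v \<in> Y" "g w \<in> Y" using neg by auto
  then show False using eq u(3) submoduleE(5)[OF Y] by simp
qed

section \<open>Maximal captured subspaces\<close>

definition captured :: "'c set \<Rightarrow> 'i set \<Rightarrow> bool"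
  where "captured Y E \<longleftrightarrow> submodule Y K M \<and> E \<subseteq> I \<and> Y \<subseteq> full E"

text \<open>Infinitely many disjoint places at which values leave \<open>Y\<close>. With
  \<open>J = I - E\<close> they allow \<open>Y\<close> to be enlarged without disturbing
  \<open>E\<close>.\<close>

definition escaping :: "'c set \<Rightarrow> 'i set \<Rightarrow> (nat \<Rightarrow> 'i set) \<Rightarrow> bool"
  where "escaping Y J S \<longleftrightarrow> (\<forall>n. S n \<subseteq> J \<and> \<not> vals (S n) \<subseteq> Y) \<and> (\<forall>m n. m \<noteq> n \<longrightarrow> S m \<inter> S n = {})"

text \<open>Values \<open>x n \<in> full (S n) - Y\<close> satisfy a linear relation.  Adding a scalar multiple of that relation
  to \<open>y \<oplus> c \<odot> x m\<close> makes all its coefficients nonzero.\<close>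

lemma captured_extend:
  assumes fd: "\<And>v. v \<in> (UNIV :: nat set) \<rightarrow> carrier M \<Longrightarrow> dependent UNIV v"
    and cap: "captured Y E" and esc: "escaping Y (I - E) S"
  shows "\<exists>Y' E'. captured Y' E' \<and> Y \<subset> Y'"
proof -
  have Y: "submodule Y K M" and E: "E \<subseteq> I" and YE: "Y \<subseteq> full E" using cap by (auto simp: captured_def)
  have S: "S n \<subseteq> I - E" "S n \<subseteq> I" "\<not> vals (S n) \<subseteq> Y" and disj: "m \<noteq> n \<Longrightarrow> S m \<inter> S n = {}" for m n
    using esc by (auto simp: escaping_def)
  obtain x where x: "\<And>n. x n \<in> full (S n)" "\<And>n. x n \<notin> Y" using full_not_subset[OF Y S(2,3)] by metis
  have xM: "x n \<in> carrier M" for n using x(1) full_closed by blast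
  then have "dependent UNIV x" by (intro fd) auto
  then obtain A l where A: "finite A" "A \<noteq> {}" and l: "\<And>n. n \<in> A \<Longrightarrow> l n \<in> carrier K" "\<And>n. n \<in> A \<Longrightarrow> l n \<noteq> \<zero>"
    and rel: "(\<Oplus>\<^bsub>M\<^esub>n\<in>A. l n \<odot>\<^bsub>M\<^esub> x n) = \<zero>\<^bsub>M\<^esub>" by (rule dependentE) blast
  obtain m where m: "m \<in> A" using A by blast
  define Y' where "Y' = {y \<oplus>\<^bsub>M\<^esub> c \<odot>\<^bsub>M\<^esub> x m | y c. y \<in> Y \<and> c \<in> carrier K}"
  define E' where "E' = E \<union> (\<Union>n\<in>A. S n)"
  have YM: "Y \<subseteq> carrier M" using submoduleE(1)[OF Y] .
  have Y0: "\<zero>\<^bsub>M\<^esub> \<in> Y" using subgroup.one_closed[OF submodule.axioms(1)[OF Y]] by simp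
  have "submodule Y' K M"
  proof (rule submoduleI)
    show "Y' \<subseteq> carrier M" using YM xM by (auto simp: Y'_def)
    show "\<zero>\<^bsub>M\<^esub> \<in> Y'" unfolding Y'_def using Y0 xM by (auto intro!: exI[of _ "\<zero>\<^bsub>M\<^esub>"] exI[of _ "\<zero>"])
  next
    fix a assume "a \<in> Y'"
    then obtain y c where yc: "a = y \<oplus>\<^bsub>M\<^esub> c \<odot>\<^bsub>M\<^esub> x m" "y \<in> Y" "c \<in> carrier K" by (auto simp: Y'_def)
    then have "\<ominus>\<^bsub>M\<^esub> a = \<ominus>\<^bsub>M\<^esub> y \<oplus>\<^bsub>M\<^esub> (\<ominus> c) \<odot>\<^bsub>M\<^esub> x m"
      using YM xM by (auto simp: M.minus_add smult_l_minus)
    then show "\<ominus>\<^bsub>M\<^esub> a \<in> Y'" using yc submoduleE(3)[OF Y] unfolding Y'_def by blast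
  next
    fix a b assume "a \<in> Y'" "b \<in> Y'"
    then obtain y c y' c' where yc: "a = y \<oplus>\<^bsub>M\<^esub> c \<odot>\<^bsub>M\<^esub> x m" "y \<in> Y" "c \<in> carrier K"
      "b = y' \<oplus>\<^bsub>M\<^esub> c' \<odot>\<^bsub>M\<^esub> x m" "y' \<in> Y" "c' \<in> carrier K" by (auto simp: Y'_def)
    have "y \<in> carrier M" "y' \<in> carrier M" using yc YM by auto
    then have "a \<oplus>\<^bsub>M\<^esub> b = (y \<oplus>\<^bsub>M\<^esub> y') \<oplus>\<^bsub>M\<^esub> (c \<oplus> c') \<odot>\<^bsub>M\<^esub> x m"
      using yc xM by (simp add: smult_l_distr M.a_ac)
    then show "a \<oplus>\<^bsub>M\<^esub> b \<in> Y'" using yc submoduleE(5)[OF Y] unfolding Y'_def by blast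
  next
    fix d a assume "d \<in> carrier K" "a \<in> Y'"
    then obtain y c where yc: "a = y \<oplus>\<^bsub>M\<^esub> c \<odot>\<^bsub>M\<^esub> x m" "y \<in> Y" "c \<in> carrier K" by (auto simp: Y'_def)
    then have "d \<odot>\<^bsub>M\<^esub> a = d \<odot>\<^bsub>M\<^esub> y \<oplus>\<^bsub>M\<^esub> (d \<otimes> c) \<odot>\<^bsub>M\<^esub> x m"
      using \<open>d \<in> carrier K\<close> YM xM by (auto simp: smult_r_distr smult_assoc1)
    then show "d \<odot>\<^bsub>M\<^esub> a \<in> Y'"
      using yc \<open>d \<in> carrier K\<close> submoduleE(4)[OF Y] unfolding Y'_def by blast
  qed
  moreover have "E' \<subseteq> I" using E S by (auto simp: E'_def)
  moreover have "Y' \<subseteq> full E'"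
  proof
    fix a assume "a \<in> Y'"
    then obtain y c where a: "a = y \<oplus>\<^bsub>M\<^esub> c \<odot>\<^bsub>M\<^esub> x m" and y: "y \<in> Y" and c: "c \<in> carrier K" by (auto simp: Y'_def)
    \<comment> \<open>The only \<open>s\<close> for which the coefficient
      \<open>s \<otimes> l m \<oplus> c\<close> of \<open>x m\<close> vanishes; avoiding it and
      \<open>\<zero>\<close> makes every \<open>d n\<close> nonzero.\<close>
    define s0 where "s0 = \<ominus> (c \<otimes> inv (l m))"
    have im: "inv (l m) \<in> carrier K" "l m \<otimes> inv (l m) = \<one>" using l m by (auto simp: field_Units)
    have "infinite (carrier K - {\<zero>, s0})" using inf by simp
    then obtain s where s: "s \<in> carrier K" "s \<noteq> \<zero>" "s \<noteq> s0" by (metis Diff_iff finite.emptyI insertCI ex_in_conv)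
    define d where "d n = s \<otimes> l n \<oplus> (if n = m then c else \<zero>)" for n
    have dK: "d n \<in> carrier K" if "n \<in> A" for n using l s c that by (auto simp: d_def)
    have d0: "d n \<noteq> \<zero>" if n: "n \<in> A" for n
    proof (cases "n = m")
      case True
      show ?thesis
      proof
        assume "d n = \<zero>"
        then have e: "s \<otimes> l m \<oplus> c = \<zero>" using True by (simp add: d_def)
        have "s = (s \<otimes> l m \<oplus> c) \<otimes> inv (l m) \<ominus> c \<otimes> inv (l m)"
        proof -
          have "(s \<otimes> l m \<oplus> c) \<otimes> inv (l m) \<ominus> c \<otimes> inv (l m) = s \<otimes> (l m \<otimes> inv (l m))"
            using s(1) l(1)[OF m] c im(1) by algebra
          then show ?thesis using im s by simp
        qed
        then show False using e s(3) im c by (simp add: s0_def R.minus_eq)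
      qed
    next
      case False
      then show ?thesis using l n s integral[of s "l n"] by (auto simp: d_def)
    qed
    have "(\<Oplus>\<^bsub>M\<^esub>n\<in>A. d n \<odot>\<^bsub>M\<^esub> x n) =
        (\<Oplus>\<^bsub>M\<^esub>n\<in>A. s \<odot>\<^bsub>M\<^esub> (l n \<odot>\<^bsub>M\<^esub> x n) \<oplus>\<^bsub>M\<^esub> (if m = n then c \<odot>\<^bsub>M\<^esub> x n else \<zero>\<^bsub>M\<^esub>))"
      using xM l s c by (intro M.finsum_cong') (auto simp: d_def smult_l_distr smult_assoc1)
    also have "\<dots> = (\<Oplus>\<^bsub>M\<^esub>n\<in>A. s \<odot>\<^bsub>M\<^esub> (l n \<odot>\<^bsub>M\<^esub> x n)) \<oplus>\<^bsub>M\<^esub> (\<Oplus>\<^bsub>M\<^esub>n\<in>A. if m = n then c \<odot>\<^bsub>M\<^esub> x n else \<zero>\<^bsub>M\<^esub>)"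
      using xM l s c by (intro M.add.finprod_multf) auto
    also have "(\<Oplus>\<^bsub>M\<^esub>n\<in>A. s \<odot>\<^bsub>M\<^esub> (l n \<odot>\<^bsub>M\<^esub> x n)) = \<zero>\<^bsub>M\<^esub>"
      using finsum_smult_ldistr[OF A(1) s(1), of "\<lambda>n. l n \<odot>\<^bsub>M\<^esub> x n"] rel xM l s by (auto simp: Pi_iff)
    also have "(\<Oplus>\<^bsub>M\<^esub>n\<in>A. if m = n then c \<odot>\<^bsub>M\<^esub> x n else \<zero>\<^bsub>M\<^esub>) = c \<odot>\<^bsub>M\<^esub> x m"
      using A m xM c by (intro M.finsum_singleton) auto
    finally have sum: "(\<Oplus>\<^bsub>M\<^esub>n\<in>A. d n \<odot>\<^bsub>M\<^esub> x n) = c \<odot>\<^bsub>M\<^esub> x m" using xM c by simp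
    have "(\<Oplus>\<^bsub>M\<^esub>n\<in>A. d n \<odot>\<^bsub>M\<^esub> x n) \<in> full (\<Union>n\<in>A. S n)"
      using A S disj x dK d0 by (intro full_finsum full_smult) auto
    then show "a \<in> full E'" unfolding a E'_def sum
      using S E y YE by (intro full_add) auto
  qed
  moreover have "Y \<subseteq> Y'"
  proof
    fix y assume "y \<in> Y"
    then have "y = y \<oplus>\<^bsub>M\<^esub> \<zero> \<odot>\<^bsub>M\<^esub> x m" using YM xM by auto
    then show "y \<in> Y'" unfolding Y'_def using \<open>y \<in> Y\<close> by blast
  qed
  moreover have "x m \<in> Y'"
  proof -
    have "x m = \<zero>\<^bsub>M\<^esub> \<oplus>\<^bsub>M\<^esub> \<one> \<odot>\<^bsub>M\<^esub> x m" using xM by simp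
    then show ?thesis unfolding Y'_def using Y0 by blast
  qed
  ultimately show ?thesis using x(2)[of m] unfolding captured_def by blast
qed

text \<open>Finite dimension enters as dependence of every sequence. Choose \<open>v n\<close> in
  \<open>Y (Suc n)\<close> but not in \<open>Y n\<close>: a relation expresses its term of largest
  index \<open>m\<close> through earlier ones, all in \<open>Y m\<close>, which forces
  \<open>v m \<in> Y m\<close>.\<close>

lemma no_increasing_submodules:
  assumes fd: "\<And>v. v \<in> (UNIV :: nat set) \<rightarrow> carrier M \<Longrightarrow> dependent UNIV v"
    and Y: "\<And>n :: nat. submodule (Y n) K M"
  shows "\<exists>n. \<not> Y n \<subset> Y (Suc n)"
proof (rule ccontr)
  assume "\<not> ?thesis"
  then have step: "Y n \<subset> Y (Suc n)" for n by blast
  have "\<exists>x. x \<in> Y (Suc n) \<and> x \<notin> Y n" for n using step[of n] by blast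
  then obtain v where v: "\<And>n. v n \<in> Y (Suc n)" "\<And>n. v n \<notin> Y n" by metis
  have vM: "v n \<in> carrier M" for n using v(1) submoduleE(1)[OF Y] by blast
  then have "dependent UNIV v" by (intro fd) auto
  then obtain A l where A: "finite A" "A \<noteq> {}" and l: "\<And>n. n \<in> A \<Longrightarrow> l n \<in> carrier K" "\<And>n. n \<in> A \<Longrightarrow> l n \<noteq> \<zero>"
    and rel: "(\<Oplus>\<^bsub>M\<^esub>n\<in>A. l n \<odot>\<^bsub>M\<^esub> v n) = \<zero>\<^bsub>M\<^esub>" by (rule dependentE) blast
  have mono: "Y i \<subseteq> Y j" if "i \<le> j" for i j using lift_Suc_mono_le[of Y i j] step that by blast
  define m where "m = Max A"
  define B where "B = A - {m}"
  have m: "m \<in> A" using A by (simp add: m_def)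
  have B: "finite B" "m \<notin> B" "insert m B = A" using A m by (auto simp: B_def)
  have less: "n < m" if "n \<in> B" for n using that A by (auto simp: B_def m_def intro: le_neq_implies_less)
  have Bsum: "(\<Oplus>\<^bsub>M\<^esub>n\<in>C. l n \<odot>\<^bsub>M\<^esub> v n) \<in> Y m" if "finite C" "C \<subseteq> B" for C
    using that
  proof (induction C rule: finite_induct)
    case empty
    then show ?case using subgroup.one_closed[OF submodule.axioms(1)[OF Y]] by simp
  next
    case (insert n C)
    have "v n \<in> Y m" using v(1)[of n] mono[of "Suc n" m] less[of n] insert.prems by auto
    then have "l n \<odot>\<^bsub>M\<^esub> v n \<in> Y m" using submoduleE(4)[OF Y] l(1) insert.prems B by auto
    moreover have "(\<Oplus>\<^bsub>M\<^esub>n\<in>insert n C. l n \<odot>\<^bsub>M\<^esub> v n) = l n \<odot>\<^bsub>M\<^esub> v n \<oplus>\<^bsub>M\<^esub> (\<Oplus>\<^bsub>M\<^esub>n\<in>C. l n \<odot>\<^bsub>M\<^esub> v n)"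
      using insert B l vM by (intro M.finsum_insert) auto
    ultimately show ?case using insert submoduleE(5)[OF Y] by auto
  qed
  define b where "b = (\<Oplus>\<^bsub>M\<^esub>n\<in>B. l n \<odot>\<^bsub>M\<^esub> v n)"
  have bY: "b \<in> Y m" and bM: "b \<in> carrier M"
    using Bsum[of B] B submoduleE(1)[OF Y] by (auto simp: b_def)
  have "(\<Oplus>\<^bsub>M\<^esub>n\<in>insert m B. l n \<odot>\<^bsub>M\<^esub> v n) = l m \<odot>\<^bsub>M\<^esub> v m \<oplus>\<^bsub>M\<^esub> b"
    unfolding b_def using B l vM by (intro M.finsum_insert) auto
  then have "l m \<odot>\<^bsub>M\<^esub> v m \<oplus>\<^bsub>M\<^esub> b = \<zero>\<^bsub>M\<^esub>" using rel B by simp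
  then have "l m \<odot>\<^bsub>M\<^esub> v m = \<ominus>\<^bsub>M\<^esub> b" using bM vM l m by (metis M.minus_equality smult_closed)
  then have lv: "l m \<odot>\<^bsub>M\<^esub> v m \<in> Y m" using bY submoduleE(3)[OF Y] by simp
  have im: "inv (l m) \<in> carrier K" "inv (l m) \<otimes> l m = \<one>" using l m by (auto simp: field_Units)
  have "v m = inv (l m) \<odot>\<^bsub>M\<^esub> (l m \<odot>\<^bsub>M\<^esub> v m)" using im l m vM by (simp flip: smult_assoc1)
  then have "v m \<in> Y m" using submoduleE(4)[OF Y im(1) lv] by simp
  then show False using v(2) by blast
qed

text \<open>Starting from the zero subspace with empty \<open>E\<close>, endless use of
  \<open>captured_extend\<close> would give a strictly increasing sequence of subspaces.\<close>

lemma captured_maximal: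
  assumes fd: "\<And>v. v \<in> (UNIV :: nat set) \<rightarrow> carrier M \<Longrightarrow> dependent UNIV v"
  shows "\<exists>Y E. captured Y E \<and> (\<forall>S. \<not> escaping Y (I - E) S)"
proof (rule ccontr)
  assume neg: "\<not> ?thesis"
  define P where "P n p \<longleftrightarrow> captured (fst p) (snd p)" for n :: nat and p
  have "submodule {\<zero>\<^bsub>M\<^esub>} K M" by (rule submoduleI) auto
  then have "P 0 ({\<zero>\<^bsub>M\<^esub>}, {})" by (simp add: P_def captured_def full_empty)
  then have ex0: "\<exists>p. P 0 p" by blast
  have step: "\<exists>q. P (Suc n) q \<and> fst p \<subset> fst q" if "P n p" for p n
    using that neg captured_extend[OF fd, of "fst p" "snd p"] unfolding P_def by (metis fst_conv snd_conv)
  obtain p where "\<forall>n. P n (p n)" "\<forall>n. fst (p n) \<subset> fst (p (Suc n))"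
    using dependent_nat_choice[of P "\<lambda>n p q. fst p \<subset> fst q", OF ex0 step] by blast
  then show False using no_increasing_submodules[OF fd, of "\<lambda>n. fst (p n)"]
    by (auto simp: P_def captured_def)
qed

text \<open>The property of \<open>S\<close> to be proved for \<open>S = I - E\<close>: a value in \<open>Y\<close> can be corrected to \<open>0\<close>
  on a set \<open>E\<close> with \<open>Y \<subseteq> full E\<close>.\<close>

definition nearly_attained :: "'c set \<Rightarrow> 'i set \<Rightarrow> bool"
  where "nearly_attained Y S \<longleftrightarrow> (\<exists>F x. finite F \<and> F \<subseteq> S \<and> x \<in> full (S - F) \<and> x \<in> Y)"

lemma nearly_attained_Un:
  assumes Y: "submodule Y K M" and S: "S \<inter> T = {}" "S \<subseteq> I" "T \<subseteq> I" and att: "nearly_attained Y S" "nearly_attained Y T"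
  shows "nearly_attained Y (S \<union> T)"
proof -
  obtain F x where F: "finite F" "F \<subseteq> S" "x \<in> full (S - F)" "x \<in> Y" using att unfolding nearly_attained_def by blast
  obtain G y where G: "finite G" "G \<subseteq> T" "y \<in> full (T - G)" "y \<in> Y" using att unfolding nearly_attained_def by blast
  have "x \<oplus>\<^bsub>M\<^esub> y \<in> full ((S - F) \<union> (T - G))" using F G S by (intro full_add) auto
  also have "(S - F) \<union> (T - G) = (S \<union> T) - (F \<union> G)" using F G S by auto
  finally show ?thesis unfolding nearly_attained_def
    using F G submoduleE(5)[OF Y] by (intro exI[of _ "F \<union> G"] exI[of _ "x \<oplus>\<^bsub>M\<^esub> y"]) auto
qed

lemma nearly_attained_diff_finite:
  assumes "vals (S - F) \<subseteq> Y" "finite F" "F \<subseteq> S"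
  shows "nearly_attained Y S"
proof -
  obtain x where "x \<in> full (S - F)" using full_nonempty by blast
  then show ?thesis unfolding nearly_attained_def using assms full_subset_vals by blast
qed

text \<open>\<open>kernel_fibrewise\<close> gives a kernel element whose zeros in \<open>P\<close>
  form a set \<open>W\<close> covered by finitely many fibres. It attains zero with full support on
  \<open>P - W\<close>, while \<open>W\<close> supports only values in \<open>Y\<close>.\<close>

lemma nearly_attained_fibrewise:
  assumes fd: "\<And>v. v \<in> carrier K \<rightarrow> carrier M \<Longrightarrow> dependent (carrier K) v"
    and Y: "submodule Y K M" and P: "P \<subseteq> I" and c: "c \<in> P \<rightarrow> carrier K"
    and fib: "\<And>z. vals {i \<in> P. c i = z} \<subseteq> Y"
  shows "nearly_attained Y P"
proof -
  obtain Z u where Z: "finite Z" and u: "u \<in> I \<rightarrow> carrier K" "\<And>i. i \<in> I - P \<Longrightarrow> u i = \<zero>"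
    "\<And>i. i \<in> P \<Longrightarrow> u i = \<zero> \<Longrightarrow> c i \<in> Z" "g u = \<zero>\<^bsub>M\<^esub>"
    using kernel_fibrewise[OF P c order_refl fd] by metis
  define W where "W = {i \<in> P. u i = \<zero>}"
  have "\<zero>\<^bsub>M\<^esub> \<in> full (P - W)" unfolding full_def using u P by (auto simp: W_def intro!: exI[of _ u])
  moreover have "\<zero>\<^bsub>M\<^esub> \<in> Y" using subgroup.one_closed[OF submodule.axioms(1)[OF Y]] by simp
  ultimately have g1: "nearly_attained Y (P - W)" unfolding nearly_attained_def by (intro exI[of _ "{}"] exI[of _ "\<zero>\<^bsub>M\<^esub>"]) auto
  have "vals W \<subseteq> vals (\<Union>z\<in>Z. {i \<in> P. c i = z})" using u(3) by (intro vals_mono) (auto simp: W_def)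
  also have "\<dots> \<subseteq> Y" using fib by (intro vals_UN_subset[OF Y Z])
  finally have g2: "nearly_attained Y W" using nearly_attained_diff_finite[of W "{}" Y] by simp
  have "W \<union> (P - W) = P" by (auto simp: W_def)
  then show ?thesis using nearly_attained_Un[OF Y _ _ _ g2 g1] P by (auto simp: W_def)
qed

text \<open>Otherwise any set that is not nearly attained splits into two parts that both support
  values outside \<open>Y\<close>. By \<open>nearly_attained_Un\<close> one part is again not nearly
  attained; keeping it each time, the discarded parts form an escaping sequence.\<close>

lemma atom_exists:
  assumes Y: "submodule Y K M" and J: "J \<subseteq> I" "\<And>S. \<not> escaping Y J S" "\<not> nearly_attained Y J"
  shows "\<exists>P\<subseteq>J. \<not> nearly_attained Y P \<and> (\<forall>Q\<subseteq>P. vals Q \<subseteq> Y \<or> vals (P - Q) \<subseteq> Y)"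
proof (rule ccontr)
  assume neg: "\<not> ?thesis"
  define R where "R n P \<longleftrightarrow> P \<subseteq> J \<and> \<not> nearly_attained Y P" for n :: nat and P
  have ex0: "\<exists>P. R 0 P" using J(3) unfolding R_def by blast
  have step: "\<exists>Q. R (Suc n) Q \<and> Q \<subseteq> P \<and> \<not> vals (P - Q) \<subseteq> Y" if "R n P" for n P
  proof -
    have P: "P \<subseteq> J" "\<not> nearly_attained Y P" using that by (simp_all add: R_def)
    have "\<not> (\<forall>Q\<subseteq>P. vals Q \<subseteq> Y \<or> vals (P - Q) \<subseteq> Y)" using neg P by metis
    then obtain Q where Q: "Q \<subseteq> P" "\<not> vals Q \<subseteq> Y" "\<not> vals (P - Q) \<subseteq> Y" by metis
    have sub: "Q \<subseteq> I" "P - Q \<subseteq> I" "P - Q \<subseteq> J" "Q \<subseteq> J" using P(1) Q(1) J(1) by blast+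
    have QP: "Q \<union> (P - Q) = P" "P - (P - Q) = Q" using Q(1) by blast+
    show ?thesis
    proof (cases "nearly_attained Y Q")
      case True
      have "\<not> nearly_attained Y (P - Q)"
        using nearly_attained_Un[OF Y Diff_disjoint sub(1,2) True] P(2) QP(1) by metis
      then have "R (Suc n) (P - Q) \<and> P - Q \<subseteq> P \<and> \<not> vals (P - (P - Q)) \<subseteq> Y"
        using sub Q(2) unfolding QP R_def by simp
      then show ?thesis by (rule exI)
    next
      case False
      then have "R (Suc n) Q \<and> Q \<subseteq> P \<and> \<not> vals (P - Q) \<subseteq> Y"
        using sub Q unfolding R_def by simp
      then show ?thesis by (rule exI)
    qed
  qed
  obtain P where P: "\<And>n. R n (P n)" "\<And>n. P (Suc n) \<subseteq> P n" "\<And>n. \<not> vals (P n - P (Suc n)) \<subseteq> Y"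
    using dependent_nat_choice[of R "\<lambda>n P Q. Q \<subseteq> P \<and> \<not> vals (P - Q) \<subseteq> Y", OF ex0 step] by metis
  have anti: "P n \<subseteq> P m" if "m \<le> n" for m n using lift_Suc_antimono_le[of P] P(2) that by blast
  have "(P m - P (Suc m)) \<inter> (P n - P (Suc n)) = {}" if "m < n" for m n
    using anti[of "Suc m" n] that by auto
  then have "(P m - P (Suc m)) \<inter> (P n - P (Suc n)) = {}" if "m \<noteq> n" for m n
    using that by (metis inf_commute linorder_neqE_nat)
  then have "escaping Y J (\<lambda>n. P n - P (Suc n))" using P(1,3) unfolding escaping_def R_def by blast
  then show False using J(2) by blast
qed

text \<open>On an atom \<open>P\<close>, the complements of sets supporting only values in
  \<open>Y\<close> form an ultrafilter. It is nonprincipal since removing one point cannot make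
  \<open>P\<close> harmless, and its completeness yields a measurable cardinal above that of the
  field and at most \<open>|I|\<close>.\<close>

lemma nearly_attained_of_below_measurables:
  assumes fd: "\<And>v. v \<in> carrier K \<rightarrow> carrier M \<Longrightarrow> dependent (carrier K) v"
    and meas: "below_measurables I (carrier K)"
    and Y: "submodule Y K M" and J: "J \<subseteq> I" "\<And>S. \<not> escaping Y J S"
  shows "nearly_attained Y J"
proof (rule ccontr)
  assume "\<not> nearly_attained Y J"
  then obtain P where P: "P \<subseteq> J" "\<not> nearly_attained Y P" and atom: "\<And>Q. Q \<subseteq> P \<Longrightarrow> vals Q \<subseteq> Y \<or> vals (P - Q) \<subseteq> Y"
    using atom_exists[OF Y J] by blast
  define U where "U = {Q. Q \<subseteq> P \<and> vals (P - Q) \<subseteq> Y}"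
  have PY: "\<not> vals P \<subseteq> Y" using P(2) nearly_attained_diff_finite[of P "{}" Y] by auto
  have Y0: "\<zero>\<^bsub>M\<^esub> \<in> Y" using subgroup.one_closed[OF submodule.axioms(1)[OF Y]] by simp
  have "ultrafilter_on P U"
    unfolding ultrafilter_on_def
  proof (intro conjI ballI allI impI)
    show "U \<subseteq> Pow P" by (auto simp: U_def)
    show "P \<in> U" using Y0 by (simp add: U_def vals_empty)
    show "{} \<notin> U" using PY by (simp add: U_def)
    show "R \<in> U" if "Q \<in> U" "Q \<subseteq> R \<and> R \<subseteq> P" for Q R
      using that vals_mono[of "P - R" "P - Q"] unfolding U_def by blast
    show "Q \<inter> R \<in> U" if "Q \<in> U" "R \<in> U" for Q R
      using that vals_Un_subset[OF Y, of "P - Q" "P - R"] by (auto simp: U_def Diff_Int)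
    show "Q \<in> U \<or> P - Q \<in> U" if "Q \<subseteq> P" for Q
      using that atom[OF that] double_diff[OF that, of P] unfolding U_def by auto
  qed
  moreover have "nonprincipal_on P U"
    unfolding nonprincipal_on_def
  proof
    assume "\<exists>x\<in>P. U = {X. X \<subseteq> P \<and> x \<in> X}"
    then obtain x where x: "x \<in> P" "U = {X. X \<subseteq> P \<and> x \<in> X}" by blast
    then have "{x} \<in> U" by auto
    then have "vals (P - {x}) \<subseteq> Y" by (simp add: U_def)
    then show False using P(2) nearly_attained_diff_finite[of P "{x}" Y] x(1) by simp
  qed
  moreover have "\<Inter>F \<in> U" if F: "F \<subseteq> U" "F \<noteq> {}" "|F| \<le>o |carrier K|" for F
  proof (rule ccontr)
    assume nU: "\<Inter>F \<notin> U"
    have FP: "\<Inter>F \<subseteq> P" using F by (auto simp: U_def)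
    have D: "vals (\<Inter>F) \<subseteq> Y" using atom[OF FP] nU FP by (auto simp: U_def)
    obtain h where h: "inj_on h F" "h ` F \<subseteq> carrier K" using F(3) card_of_ordLeq by metis
    \<comment> \<open>Colour each point outside \<open>\<Inter>F\<close> by a member of
      \<open>F\<close> missing it, and turn colours into scalars by \<open>h\<close>. A colour class
      avoids its member of \<open>U\<close>, hence supports only values in \<open>Y\<close>.\<close>
    have "\<forall>i\<in>P - \<Inter>F. \<exists>X\<in>F. i \<notin> X" by auto
    then obtain X where X: "\<And>i. i \<in> P - \<Inter>F \<Longrightarrow> X i \<in> F" "\<And>i. i \<in> P - \<Inter>F \<Longrightarrow> i \<notin> X i" by metis
    have "nearly_attained Y (P - \<Inter>F)"
    proof (rule nearly_attained_fibrewise[OF fd Y, of _ "\<lambda>i. h (X i)"])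
      show "P - \<Inter>F \<subseteq> I" using P(1) J(1) by auto
      show "(\<lambda>i. h (X i)) \<in> P - \<Inter>F \<rightarrow> carrier K" using X(1) h(2) by blast
      show "vals {i \<in> P - \<Inter>F. h (X i) = z} \<subseteq> Y" for z
      proof (cases "{i \<in> P - \<Inter>F. h (X i) = z} = {}")
        case True
        then show ?thesis using Y0 by (simp only: vals_empty) simp
      next
        case False
        then obtain j where j: "j \<in> P - \<Inter>F" "h (X j) = z" by blast
        have "X i = X j" if "i \<in> P - \<Inter>F" "h (X i) = z" for i
          using inj_onD[OF h(1), of "X i" "X j"] X(1) that j by auto
        then have "{i \<in> P - \<Inter>F. h (X i) = z} \<subseteq> P - X j" using X(2) by auto
        then have "vals {i \<in> P - \<Inter>F. h (X i) = z} \<subseteq> vals (P - X j)" by (rule vals_mono)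
        also have "\<dots> \<subseteq> Y" using X(1)[OF j(1)] F(1) by (auto simp: U_def)
        finally show ?thesis .
      qed
    qed
    moreover have "nearly_attained Y (\<Inter>F)" using nearly_attained_diff_finite[of "\<Inter>F" "{}" Y] D by simp
    ultimately have "nearly_attained Y ((P - \<Inter>F) \<union> \<Inter>F)" using P(1) J(1) FP by (intro nearly_attained_Un[OF Y]) auto
    then show False using P(2) FP by (simp add: Un_absorb2)
  qed
  ultimately obtain D where D: "D \<subseteq> P" "measurable_cardinal |D|" "|carrier K| <o |D|"
    using ultrafilter_imp_measurable_cardinal[of P U "carrier K"] by blast
  then have "|I| <o |D|" using meas unfolding below_measurables_def by blast
  moreover have "|D| \<le>o |I|" using D(1) P(1) J(1) by (intro card_of_mono1) auto
  ultimately show False using not_ordLess_ordLeq by blast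
qed

text \<open>A value \<open>x \<in> Y\<close> attained on \<open>I - E\<close> up to a finite set is
  cancelled by its negative, which lies in \<open>Y\<close> too and is attained with support exactly
  \<open>E\<close>.\<close>

lemma kernel_of_below_measurables:
  assumes S: "lin_basis K M S" "finite S" and meas: "below_measurables I (carrier K)"
  obtains u where "u \<in> I \<rightarrow> carrier K" "finite {i \<in> I. u i = \<zero>}" "g u = \<zero>\<^bsub>M\<^esub>"
proof -
  have S': "S \<subseteq> carrier M" "lin_span K M S = carrier M" using S(1) by (auto simp: lin_basis_def lin_indep_def)
  have fd1: "dependent UNIV v" if "v \<in> (UNIV :: nat set) \<rightarrow> carrier M" for v
    using dependent_in_finite_span[OF S(2) S'(1) infinite_UNIV_nat] S' that by simp
  have fd2: "dependent (carrier K) v" if "v \<in> carrier K \<rightarrow> carrier M" for v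
    using dependent_in_finite_span[OF S(2) S'(1) inf] S' that by simp
  obtain Y E where cap: "captured Y E" and max: "\<And>S. \<not> escaping Y (I - E) S"
    using captured_maximal[OF fd1] by blast
  have Y: "submodule Y K M" and E: "E \<subseteq> I" and YE: "Y \<subseteq> full E" using cap by (auto simp: captured_def)
  have "nearly_attained Y (I - E)" by (rule nearly_attained_of_below_measurables[OF fd2 meas Y _ max]) auto
  then obtain F x where F: "finite F" "F \<subseteq> I - E" "x \<in> full (I - E - F)" "x \<in> Y" unfolding nearly_attained_def by blast
  have "x \<oplus>\<^bsub>M\<^esub> \<ominus>\<^bsub>M\<^esub> x \<in> full ((I - E - F) \<union> E)"
    using F(3,4) submoduleE(3)[OF Y] YE E by (intro full_add) auto
  moreover have "(I - E - F) \<union> E = I - F" using E F(2) by auto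
  moreover have "x \<oplus>\<^bsub>M\<^esub> \<ominus>\<^bsub>M\<^esub> x = \<zero>\<^bsub>M\<^esub>" using F(4) submoduleE(1)[OF Y] by (auto simp: M.r_neg)
  ultimately have "\<zero>\<^bsub>M\<^esub> \<in> full (I - F)" by simp
  then obtain u where u: "u \<in> I \<rightarrow> carrier K" "\<And>i. i \<in> I - F \<Longrightarrow> u i \<noteq> \<zero>" "g u = \<zero>\<^bsub>M\<^esub>"
    unfolding full_def by fastforce
  have "{i \<in> I. u i = \<zero>} \<subseteq> F" using u(2) by blast
  then show thesis using that u F(1) finite_subset by blast
qed

end


section \<open>Homomorphisms on product algebras\<close>

lemma mult_zero:
  assumes "nonassoc_algebra K M" "x \<in> carrier M"
  shows "\<zero>\<^bsub>M\<^esub> \<otimes>\<^bsub>M\<^esub> x = \<zero>\<^bsub>M\<^esub>" "x \<otimes>\<^bsub>M\<^esub> \<zero>\<^bsub>M\<^esub> = \<zero>\<^bsub>M\<^esub>"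
proof -
  interpret M: nonassoc_algebra K M by fact
  have "\<zero>\<^bsub>M\<^esub> \<otimes>\<^bsub>M\<^esub> x = (\<zero>\<^bsub>K\<^esub> \<odot>\<^bsub>M\<^esub> \<zero>\<^bsub>M\<^esub>) \<otimes>\<^bsub>M\<^esub> x" by simp
  also have "\<dots> = \<zero>\<^bsub>M\<^esub>"
    using assms(2) by (subst M.smult_mult_l) (auto simp: M.mult_closed)
  finally show "\<zero>\<^bsub>M\<^esub> \<otimes>\<^bsub>M\<^esub> x = \<zero>\<^bsub>M\<^esub>" .
  have "x \<otimes>\<^bsub>M\<^esub> \<zero>\<^bsub>M\<^esub> = x \<otimes>\<^bsub>M\<^esub> (\<zero>\<^bsub>K\<^esub> \<odot>\<^bsub>M\<^esub> \<zero>\<^bsub>M\<^esub>)" by simp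
  also have "\<dots> = \<zero>\<^bsub>M\<^esub>"
    using assms(2) by (subst M.smult_mult_r) (auto simp: M.mult_closed)
  finally show "x \<otimes>\<^bsub>M\<^esub> \<zero>\<^bsub>M\<^esub> = \<zero>\<^bsub>M\<^esub>" .
qed

locale product_hom =
  fixes K :: "('k, 'm) ring_scheme" and I :: "'i set"
    and A :: "'i \<Rightarrow> ('k, 'a, 'n) module_scheme"
    and B :: "('k, 'b, 'p) module_scheme" and f :: "('i \<Rightarrow> 'a) \<Rightarrow> 'b"
  assumes K: "field K"
    and A: "\<And>i. i \<in> I \<Longrightarrow> nonassoc_algebra K (A i)"
    and B: "nonassoc_algebra K B"
    and f: "f \<in> alg_hom K (prod_alg I A) B"
    and onto: "f ` carrier (prod_alg I A) = carrier B"
begin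

sublocale B: nonassoc_algebra K B by (rule B)

lemma A_module: "i \<in> I \<Longrightarrow> module K (A i)"
  using A nonassoc_algebra.axioms(1) by blast

lemma A_group: "i \<in> I \<Longrightarrow> abelian_group (A i)"
  using A_module module.axioms(2) by blast

abbreviation "P \<equiv> prod_alg I A"

text \<open>The projection onto the factors in \<open>S\<close>, filled up with zeros so that it
  stays in the full product and \<open>f\<close> can be applied.\<close>

definition mask :: "'i set \<Rightarrow> ('i \<Rightarrow> 'a) \<Rightarrow> 'i \<Rightarrow> 'a"
  where "mask S a = (\<lambda>i\<in>I. if i \<in> S then a i else \<zero>\<^bsub>A i\<^esub>)"

lemma carrier_P: "carrier P = (\<Pi>\<^sub>E i\<in>I. carrier (A i))"
  by (simp add: prod_alg_def)

lemma P_ops: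
  "a \<oplus>\<^bsub>P\<^esub> b = (\<lambda>i\<in>I. a i \<oplus>\<^bsub>A i\<^esub> b i)" "a \<otimes>\<^bsub>P\<^esub> b = (\<lambda>i\<in>I. a i \<otimes>\<^bsub>A i\<^esub> b i)"
  "c \<odot>\<^bsub>P\<^esub> a = (\<lambda>i\<in>I. c \<odot>\<^bsub>A i\<^esub> a i)"
  by (simp_all add: prod_alg_def)

lemma A_zero: "i \<in> I \<Longrightarrow> \<zero>\<^bsub>A i\<^esub> \<in> carrier (A i)"
  using A_group abelian_group.axioms(1) abelian_monoid.zero_closed by blast

lemma P_E: "a \<in> carrier P \<Longrightarrow> i \<in> I \<Longrightarrow> a i \<in> carrier (A i)"
  by (auto simp: carrier_P)

lemma f_closed: "a \<in> carrier P \<Longrightarrow> f a \<in> carrier B"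
  and f_add: "a \<in> carrier P \<Longrightarrow> b \<in> carrier P \<Longrightarrow> f (a \<oplus>\<^bsub>P\<^esub> b) = f a \<oplus>\<^bsub>B\<^esub> f b"
  and f_mult: "a \<in> carrier P \<Longrightarrow> b \<in> carrier P \<Longrightarrow> f (a \<otimes>\<^bsub>P\<^esub> b) = f a \<otimes>\<^bsub>B\<^esub> f b"
  and f_smult: "c \<in> carrier K \<Longrightarrow> a \<in> carrier P \<Longrightarrow> f (c \<odot>\<^bsub>P\<^esub> a) = c \<odot>\<^bsub>B\<^esub> f a"
  using f by (auto simp: alg_hom_def)

lemma mask_closed: "a \<in> carrier P \<Longrightarrow> mask S a \<in> carrier P"
  using A_zero by (auto simp: carrier_P mask_def)

lemma A_add_zero:
  assumes "i \<in> I" "x \<in> carrier (A i)"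
  shows "x \<oplus>\<^bsub>A i\<^esub> \<zero>\<^bsub>A i\<^esub> = x" "\<zero>\<^bsub>A i\<^esub> \<oplus>\<^bsub>A i\<^esub> x = x"
proof -
  interpret abelian_group "A i" using assms A_group by blast
  show "x \<oplus>\<^bsub>A i\<^esub> \<zero>\<^bsub>A i\<^esub> = x" "\<zero>\<^bsub>A i\<^esub> \<oplus>\<^bsub>A i\<^esub> x = x" using assms by auto
qed

lemma mask_Un:
  assumes "a \<in> carrier P" "S \<inter> T = {}"
  shows "mask (S \<union> T) a = mask S a \<oplus>\<^bsub>P\<^esub> mask T a"
proof (rule ext)
  fix i show "mask (S \<union> T) a i = (mask S a \<oplus>\<^bsub>P\<^esub> mask T a) i"
    using assms(2) A_add_zero[OF _ P_E[OF assms(1)]] A_add_zero[OF _ A_zero]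
    by (auto simp: mask_def P_ops)
qed

lemma mask_all: "a \<in> carrier P \<Longrightarrow> mask I a = a"
  by (auto simp: mask_def carrier_P PiE_def extensional_def)

lemma mask_add:
  assumes "a \<in> carrier P" "b \<in> carrier P"
  shows "mask S (a \<oplus>\<^bsub>P\<^esub> b) = mask S a \<oplus>\<^bsub>P\<^esub> mask S b"
  using A_add_zero[OF _ A_zero] by (auto simp: mask_def P_ops)

lemma mask_mult:
  assumes "a \<in> carrier P" "b \<in> carrier P"
  shows "mask S (a \<otimes>\<^bsub>P\<^esub> b) = mask S a \<otimes>\<^bsub>P\<^esub> mask S b"
  using mult_zero[OF A A_zero] by (auto simp: mask_def P_ops)

lemma mask_smult:
  assumes "c \<in> carrier K" "a \<in> carrier P"
  shows "mask S (c \<odot>\<^bsub>P\<^esub> a) = c \<odot>\<^bsub>P\<^esub> mask S a"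
  using module.smult_r_null[OF A_module] assms by (auto simp: mask_def P_ops)

text \<open>Only coordinate \<open>i\<close> survives on either side. Annihilation by a large part
  of \<open>a\<close> thus passes to its single coordinates.\<close>

lemma mask_single_mult:
  assumes "a \<in> carrier P" "b \<in> carrier P" "i \<in> S"
  shows "mask {i} a \<otimes>\<^bsub>P\<^esub> b = mask S a \<otimes>\<^bsub>P\<^esub> mask {i} b" "b \<otimes>\<^bsub>P\<^esub> mask {i} a = mask {i} b \<otimes>\<^bsub>P\<^esub> mask S a"
  using assms(3) mult_zero[OF A P_E[OF assms(1)]] mult_zero[OF A P_E[OF assms(2)]] mult_zero[OF A A_zero]
  by (auto simp: mask_def P_ops)

text \<open>Surjectivity of \<open>f\<close> reduces annihilation of \<open>B\<close> to products
  formed in the domain.\<close>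

lemma tot_annI:
  assumes "a \<in> carrier P" "\<And>b. b \<in> carrier P \<Longrightarrow> f (a \<otimes>\<^bsub>P\<^esub> b) = \<zero>\<^bsub>B\<^esub> \<and> f (b \<otimes>\<^bsub>P\<^esub> a) = \<zero>\<^bsub>B\<^esub>"
  shows "f a \<in> tot_ann B"
  unfolding tot_ann_def
proof (intro CollectI conjI ballI)
  show "f a \<in> carrier B" using assms f_closed by blast
  fix y assume "y \<in> carrier B"
  then obtain b where b: "b \<in> carrier P" "y = f b" using onto by blast
  then show "f a \<otimes>\<^bsub>B\<^esub> y = \<zero>\<^bsub>B\<^esub>" "y \<otimes>\<^bsub>B\<^esub> f a = \<zero>\<^bsub>B\<^esub>" using assms f_mult by force+
qed

lemma tot_ann_add:
  assumes "x \<in> tot_ann B" "y \<in> tot_ann B"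
  shows "x \<oplus>\<^bsub>B\<^esub> y \<in> tot_ann B"
  using assms by (auto simp: tot_ann_def B.mult_l_distr B.mult_r_distr)

definition scale :: "('i \<Rightarrow> 'a) \<Rightarrow> ('i \<Rightarrow> 'k) \<Rightarrow> 'i \<Rightarrow> 'a"
  where "scale a u = (\<lambda>i\<in>I. u i \<odot>\<^bsub>A i\<^esub> a i)"

lemma scale_closed: "a \<in> carrier P \<Longrightarrow> u \<in> I \<rightarrow> carrier K \<Longrightarrow> scale a u \<in> carrier P"
  using module.smult_closed[OF A_module] by (auto simp: carrier_P scale_def PiE_iff Pi_iff)

lemma evaluation_scale:
  assumes a: "a \<in> carrier P" and inf: "infinite (carrier K)"
  shows "evaluation K B I (\<lambda>u. f (scale a u))"
proof (intro evaluation.intro evaluation_axioms.intro vspace.intro)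
  show "module K B" by (rule B.module_axioms)
  show "field K" by (rule K)
  show "infinite (carrier K)" by (rule inf)
  show "f (scale a u) \<in> carrier B" if "u \<in> I \<rightarrow> carrier K" for u using that a by (intro f_closed scale_closed)
  show "f (scale a (\<lambda>i. u i \<oplus>\<^bsub>K\<^esub> w i)) = f (scale a u) \<oplus>\<^bsub>B\<^esub> f (scale a w)"
    if "u \<in> I \<rightarrow> carrier K" "w \<in> I \<rightarrow> carrier K" for u w
  proof -
    have "scale a (\<lambda>i. u i \<oplus>\<^bsub>K\<^esub> w i) = scale a u \<oplus>\<^bsub>P\<^esub> scale a w"
      using that P_E[OF a] module.smult_l_distr[OF A_module]
      by (auto simp: scale_def P_ops Pi_iff)
    then show ?thesis using f_add scale_closed a that by simp
  qed
  show "f (scale a (\<lambda>i. c \<otimes>\<^bsub>K\<^esub> u i)) = c \<odot>\<^bsub>B\<^esub> f (scale a u)"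
    if "c \<in> carrier K" "u \<in> I \<rightarrow> carrier K" for c u
  proof -
    have "scale a (\<lambda>i. c \<otimes>\<^bsub>K\<^esub> u i) = c \<odot>\<^bsub>P\<^esub> scale a u"
      using that P_E[OF a] module.smult_assoc1[OF A_module]
      by (auto simp: scale_def P_ops Pi_iff)
    then show ?thesis using f_smult scale_closed a that by simp
  qed
  show "f (scale a u) = f (scale a w)" if "u \<in> I \<rightarrow> carrier K" "\<And>i. i \<in> I \<Longrightarrow> u i = w i" for u w
  proof -
    have "scale a u = scale a w" using that(2) by (auto simp: scale_def)
    then show ?thesis by simp
  qed
qed

text \<open>Off the zero set \<open>F\<close> of \<open>u\<close> one has \<open>(u a) (u\<^sup>-\<^sup>1 b) = a b\<close>, so \<open>f (u a) = 0\<close> makes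
  \<open>f a\<close> annihilate everything once \<open>a\<close> is cut down to \<open>I - F\<close>.\<close>

lemma mask_in_tot_ann:
  assumes a: "a \<in> carrier P" and u: "u \<in> I \<rightarrow> carrier K" "f (scale a u) = \<zero>\<^bsub>B\<^esub>"
  shows "f (mask (I - {i \<in> I. u i = \<zero>\<^bsub>K\<^esub>}) a) \<in> tot_ann B"
proof (rule tot_annI)
  let ?F = "{i \<in> I. u i = \<zero>\<^bsub>K\<^esub>}"
  show "mask (I - ?F) a \<in> carrier P" using a by (rule mask_closed)
  fix b assume b: "b \<in> carrier P"
  interpret F: field K by (rule K)
  \<comment> \<open>The default zero agrees with \<open>mask\<close>, which is also zero where
    \<open>u\<close> vanishes.\<close>
  define v where "v i = (if u i = \<zero>\<^bsub>K\<^esub> then \<zero>\<^bsub>K\<^esub> else inv\<^bsub>K\<^esub> (u i))" for i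
  have uK: "u i \<in> carrier K" if "i \<in> I" for i using u that by auto
  have vK: "v i \<in> carrier K" if "i \<in> I" for i using uK[OF that] by (auto simp: v_def F.field_Units)
  have uv: "u i \<otimes>\<^bsub>K\<^esub> v i = \<one>\<^bsub>K\<^esub>" if "i \<in> I" "u i \<noteq> \<zero>\<^bsub>K\<^esub>" for i
    using uK[OF that(1)] that(2) by (auto simp: v_def F.field_Units)
  have v: "scale b v \<in> carrier P" using b vK by (intro scale_closed) auto
  have su: "scale a u \<in> carrier P" using a u by (intro scale_closed)
  have key: "(u i \<odot>\<^bsub>A i\<^esub> x) \<otimes>\<^bsub>A i\<^esub> (v i \<odot>\<^bsub>A i\<^esub> y) = (if u i = \<zero>\<^bsub>K\<^esub> then \<zero>\<^bsub>A i\<^esub> else x \<otimes>\<^bsub>A i\<^esub> y)"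
    "(v i \<odot>\<^bsub>A i\<^esub> y) \<otimes>\<^bsub>A i\<^esub> (u i \<odot>\<^bsub>A i\<^esub> x) = (if u i = \<zero>\<^bsub>K\<^esub> then \<zero>\<^bsub>A i\<^esub> else y \<otimes>\<^bsub>A i\<^esub> x)"
    if i: "i \<in> I" and xy: "x \<in> carrier (A i)" "y \<in> carrier (A i)" for i x y
  proof -
    interpret Ai: nonassoc_algebra K "A i" using A i by blast
    note c = uK[OF i] vK[OF i] xy Ai.mult_closed
    have vu: "v i \<otimes>\<^bsub>K\<^esub> u i = u i \<otimes>\<^bsub>K\<^esub> v i" using c by (simp add: B.R.m_comm)
    have "(u i \<odot>\<^bsub>A i\<^esub> x) \<otimes>\<^bsub>A i\<^esub> (v i \<odot>\<^bsub>A i\<^esub> y) = (u i \<otimes>\<^bsub>K\<^esub> v i) \<odot>\<^bsub>A i\<^esub> (x \<otimes>\<^bsub>A i\<^esub> y)"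
      unfolding vu[symmetric] using c by (simp add: Ai.smult_mult_l Ai.smult_mult_r Ai.smult_assoc1)
    moreover have "(v i \<odot>\<^bsub>A i\<^esub> y) \<otimes>\<^bsub>A i\<^esub> (u i \<odot>\<^bsub>A i\<^esub> x) = (u i \<otimes>\<^bsub>K\<^esub> v i) \<odot>\<^bsub>A i\<^esub> (y \<otimes>\<^bsub>A i\<^esub> x)"
      using c by (simp add: Ai.smult_mult_l Ai.smult_mult_r Ai.smult_assoc1)
    ultimately show "(u i \<odot>\<^bsub>A i\<^esub> x) \<otimes>\<^bsub>A i\<^esub> (v i \<odot>\<^bsub>A i\<^esub> y) = (if u i = \<zero>\<^bsub>K\<^esub> then \<zero>\<^bsub>A i\<^esub> else x \<otimes>\<^bsub>A i\<^esub> y)"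
      "(v i \<odot>\<^bsub>A i\<^esub> y) \<otimes>\<^bsub>A i\<^esub> (u i \<odot>\<^bsub>A i\<^esub> x) = (if u i = \<zero>\<^bsub>K\<^esub> then \<zero>\<^bsub>A i\<^esub> else y \<otimes>\<^bsub>A i\<^esub> x)"
      using c uv[OF i] by auto
  qed
  have "mask (I - ?F) a \<otimes>\<^bsub>P\<^esub> b = scale a u \<otimes>\<^bsub>P\<^esub> scale b v"
    using key[OF _ P_E[OF a] P_E[OF b]] mult_zero(1)[OF A P_E[OF b]]
    by (auto simp: mask_def scale_def P_ops)
  moreover have "b \<otimes>\<^bsub>P\<^esub> mask (I - ?F) a = scale b v \<otimes>\<^bsub>P\<^esub> scale a u"
    using key[OF _ P_E[OF a] P_E[OF b]] mult_zero(2)[OF A P_E[OF b]]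
    by (auto simp: mask_def scale_def P_ops)
  ultimately show "f (mask (I - ?F) a \<otimes>\<^bsub>P\<^esub> b) = \<zero>\<^bsub>B\<^esub> \<and> f (b \<otimes>\<^bsub>P\<^esub> mask (I - ?F) a) = \<zero>\<^bsub>B\<^esub>"
    using f_mult su v u(2) mult_zero[OF B f_closed[OF v]] by simp
qed

end

section \<open>Splitting off finitely many factors\<close>

locale product_hom_kernel = product_hom +
  assumes kernel: "a \<in> carrier (prod_alg I A) \<Longrightarrow>
    \<exists>u. u \<in> I \<rightarrow> carrier K \<and> finite {i \<in> I. u i = \<zero>\<^bsub>K\<^esub>} \<and> f (scale a u) = \<zero>\<^bsub>B\<^esub>"
begin

text \<open>\<open>F\<close> is the zero set of the \<open>u\<close> given by \<open>kernel\<close>,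
  the assumption that each of the three cases of the theorem supplies.\<close>

lemma cofinite_part_in_tot_ann:
  assumes "a \<in> carrier P"
  shows "\<exists>F. finite F \<and> F \<subseteq> I \<and> f (mask (I - F) a) \<in> tot_ann B"
  using kernel[OF assms] mask_in_tot_ann[OF assms] by (metis (no_types, lifting) mem_Collect_eq subsetI)

text \<open>Central refers to the total annihilator, not to commutation: these are the indices whose
  factor is not mapped into it.\<close>

definition noncentral
  where "noncentral = {i \<in> I. \<exists>a\<in>carrier P. f (mask {i} a) \<notin> tot_ann B}"

text \<open>One witness per index is assembled into a single \<open>a\<close>. A cofinite part of
  \<open>a\<close> goes to the annihilator, hence so does each coordinate outside \<open>F\<close>,
  so no witness can sit there.\<close>

lemma finite_noncentral: "finite noncentral"
proof -
  have "\<forall>i\<in>noncentral. \<exists>a\<in>carrier P. f (mask {i} a) \<notin> tot_ann B" by (auto simp: noncentral_def)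
  then obtain c where c: "\<And>i. i \<in> noncentral \<Longrightarrow> c i \<in> carrier P" "\<And>i. i \<in> noncentral \<Longrightarrow> f (mask {i} (c i)) \<notin> tot_ann B" by metis
  define a where "a = (\<lambda>i\<in>I. if i \<in> noncentral then c i i else \<zero>\<^bsub>A i\<^esub>)"
  have a: "a \<in> carrier P" using P_E[OF c(1)] A_zero by (auto simp: a_def carrier_P)
  obtain F where F: "finite F" "F \<subseteq> I" "f (mask (I - F) a) \<in> tot_ann B"
    using cofinite_part_in_tot_ann[OF a] by blast
  have "i \<in> F" if i: "i \<in> noncentral" for i
  proof (rule ccontr)
    assume "i \<notin> F"
    then have iF: "i \<in> I - F" using i by (auto simp: noncentral_def)
    have eq: "mask {i} (c i) = mask {i} a" using i by (auto simp: mask_def a_def)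
    have "f (mask {i} a) \<in> tot_ann B"
    proof (rule tot_annI)
      show "mask {i} a \<in> carrier P" using a by (rule mask_closed)
      fix b assume b: "b \<in> carrier P"
      let ?x = "f (mask (I - F) a)" and ?y = "f (mask {i} b)"
      have "f (mask {i} a \<otimes>\<^bsub>P\<^esub> b) = ?x \<otimes>\<^bsub>B\<^esub> ?y" "f (b \<otimes>\<^bsub>P\<^esub> mask {i} a) = ?y \<otimes>\<^bsub>B\<^esub> ?x"
        unfolding mask_single_mult[OF a b iF] by (intro f_mult mask_closed a b)+
      moreover have "?y \<in> carrier B" by (intro f_closed mask_closed b)
      ultimately show "f (mask {i} a \<otimes>\<^bsub>P\<^esub> b) = \<zero>\<^bsub>B\<^esub> \<and> f (b \<otimes>\<^bsub>P\<^esub> mask {i} a) = \<zero>\<^bsub>B\<^esub>"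
        using F(3) by (simp add: tot_ann_def)
    qed
    then show False using c(2)[OF i] eq by simp
  qed
  then have "noncentral \<subseteq> F" by (rule subsetI)
  then show ?thesis using F(1) by (rule finite_subset)
qed

lemma finite_part_in_tot_ann:
  assumes "finite F" "F \<subseteq> I - noncentral" "a \<in> carrier P"
  shows "f (mask F a) \<in> tot_ann B"
  using assms(1,2)
proof (induction F rule: finite_induct)
  case empty
  show ?case
  proof (rule tot_annI[OF mask_closed[OF assms(3)]])
    fix b assume b: "b \<in> carrier P"
    define z where "z = (\<lambda>i\<in>I. \<zero>\<^bsub>A i\<^esub>)"
    have z: "z \<in> carrier P" using A_zero by (auto simp: z_def carrier_P)
    have "z = \<zero>\<^bsub>K\<^esub> \<odot>\<^bsub>P\<^esub> z"
      using module.smult_l_null[OF A_module A_zero] by (auto simp: z_def P_ops)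
    then have "f z = \<zero>\<^bsub>B\<^esub>" using f_smult[of "\<zero>\<^bsub>K\<^esub>" z] z f_closed[OF z] by simp
    moreover have "mask {} a \<otimes>\<^bsub>P\<^esub> b = z" "b \<otimes>\<^bsub>P\<^esub> mask {} a = z"
      using mult_zero[OF A P_E[OF b]] by (auto simp: z_def mask_def P_ops)
    ultimately show "f (mask {} a \<otimes>\<^bsub>P\<^esub> b) = \<zero>\<^bsub>B\<^esub> \<and> f (b \<otimes>\<^bsub>P\<^esub> mask {} a) = \<zero>\<^bsub>B\<^esub>" by simp
  qed
next
  case (insert i F)
  have "mask ({i} \<union> F) a = mask {i} a \<oplus>\<^bsub>P\<^esub> mask F a"
    using insert.hyps assms(3) by (intro mask_Un) auto
  then have "f (mask (insert i F) a) = f (mask {i} a) \<oplus>\<^bsub>B\<^esub> f (mask F a)"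
    using f_add mask_closed assms(3) by simp
  moreover have "f (mask {i} a) \<in> tot_ann B" using insert.prems assms(3) by (auto simp: noncentral_def)
  ultimately show ?case using insert tot_ann_add by simp
qed

text \<open>A cofinite part is covered by \<open>cofinite_part_in_tot_ann\<close>; the finitely many
  remaining coordinates outside \<open>noncentral\<close> are covered one by one.\<close>

lemma mask_noncentral_in_tot_ann:
  assumes a: "a \<in> carrier P"
  shows "f (mask (I - noncentral) a) \<in> tot_ann B"
proof -
  define a' where "a' = mask (I - noncentral) a"
  have a': "a' \<in> carrier P" unfolding a'_def using a by (rule mask_closed)
  obtain F where F: "finite F" "F \<subseteq> I" "f (mask (I - F) a') \<in> tot_ann B"
    using cofinite_part_in_tot_ann[OF a'] by blast
  have "mask ((F - noncentral) \<union> (I - F)) a' = mask (F - noncentral) a' \<oplus>\<^bsub>P\<^esub> mask (I - F) a'"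
    using a' by (intro mask_Un) auto
  \<comment> \<open>\<open>a'\<close> vanishes on \<open>noncentral\<close>, so leaving out
    \<open>F \<inter> noncentral\<close> loses nothing.\<close>
  moreover have "mask ((F - noncentral) \<union> (I - F)) a' = a'" by (auto simp: a'_def mask_def)
  ultimately have "f a' = f (mask (F - noncentral) a') \<oplus>\<^bsub>B\<^esub> f (mask (I - F) a')"
    using f_add mask_closed a' by metis
  moreover have "f (mask (F - noncentral) a') \<in> tot_ann B"
    using F a' by (intro finite_part_in_tot_ann) auto
  ultimately show ?thesis using F(3) tot_ann_add unfolding a'_def by simp
qed

lemma f_split:
  assumes "a \<in> carrier P"
  shows "f a = f (mask noncentral a) \<oplus>\<^bsub>B\<^esub> f (mask (I - noncentral) a)"
proof -
  have "mask (noncentral \<union> (I - noncentral)) a = mask noncentral a \<oplus>\<^bsub>P\<^esub> mask (I - noncentral) a" using assms by (intro mask_Un) auto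
  moreover have "noncentral \<union> (I - noncentral) = I" by (auto simp: noncentral_def)
  ultimately show ?thesis using assms f_add mask_closed mask_all by metis
qed

lemma carrier_decomposition: "carrier B = f ` fin_supp I A <+>\<^bsub>B\<^esub> tot_ann B"
proof
  have "f ` fin_supp I A \<subseteq> carrier B" using f_closed by (auto simp: fin_supp_def)
  then show "f ` fin_supp I A <+>\<^bsub>B\<^esub> tot_ann B \<subseteq> carrier B"
    by (auto simp: AbelCoset.set_add_def set_mult_def tot_ann_def)
  show "carrier B \<subseteq> f ` fin_supp I A <+>\<^bsub>B\<^esub> tot_ann B"
  proof
    fix y assume "y \<in> carrier B"
    then obtain a where a: "a \<in> carrier P" "y = f a" using onto by blast
    have "supp I A (mask noncentral a) \<subseteq> noncentral" by (auto simp: supp_def mask_def)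
    then have "mask noncentral a \<in> fin_supp I A"
      using finite_noncentral finite_subset mask_closed[OF a(1)] by (auto simp: fin_supp_def)
    then show "y \<in> f ` fin_supp I A <+>\<^bsub>B\<^esub> tot_ann B"
      using f_split[OF a(1)] mask_noncentral_in_tot_ann[OF a(1)] a(2)
      by (auto simp: AbelCoset.set_add_def set_mult_def)
  qed
qed

text \<open>\<open>mask S\<close> is an algebra endomorphism of the product, since zero times zero
  is zero in each factor.\<close>

lemma mask_hom: "(\<lambda>a. f (mask S a)) \<in> alg_hom K P B"
  unfolding alg_hom_def
  using mask_closed f_closed mask_add mask_mult mask_smult f_add f_mult f_smult by auto

lemma mask_tot_ann_hom: "(\<lambda>a. f (mask (I - noncentral) a)) \<in> alg_hom K P (tot_ann_alg B)"
  using mask_hom[of "I - noncentral"] mask_noncentral_in_tot_ann by (auto simp: alg_hom_def tot_ann_alg_def)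

text \<open>The map through which \<open>f1\<close> factors. \<open>mask noncentral\<close> reads
  only coordinates in \<open>noncentral\<close>, so the formula applies to the smaller product as
  well; \<open>ext\<close> extends by zero to compare the operations.\<close>

lemma extend_hom: "(\<lambda>b. f (mask noncentral b)) \<in> alg_hom K (prod_alg noncentral A) B"
proof -
  have JI: "noncentral \<subseteq> I" by (auto simp: noncentral_def)
  define ext where "ext b = (\<lambda>i\<in>I. if i \<in> noncentral then b i else \<zero>\<^bsub>A i\<^esub>)" for b
  have ext: "ext b \<in> carrier P" "mask noncentral b = mask noncentral (ext b)" if "b \<in> carrier (prod_alg noncentral A)" for b
    using that A_zero JI by (auto simp: ext_def mask_def carrier_P prod_alg_def)
  have ops: "mask noncentral (b \<oplus>\<^bsub>prod_alg noncentral A\<^esub> c) = mask noncentral (ext b \<oplus>\<^bsub>P\<^esub> ext c)"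
    "mask noncentral (b \<otimes>\<^bsub>prod_alg noncentral A\<^esub> c) = mask noncentral (ext b \<otimes>\<^bsub>P\<^esub> ext c)"
    "mask noncentral (d \<odot>\<^bsub>prod_alg noncentral A\<^esub> b) = mask noncentral (d \<odot>\<^bsub>P\<^esub> ext b)" for b c d
    using JI by (auto simp: ext_def mask_def prod_alg_def)
  show ?thesis
    unfolding alg_hom_def
    using mask_hom[of noncentral] ext ops by (auto simp: alg_hom_def)
qed

lemma mask_restrict: "mask noncentral (restrict a noncentral) = mask noncentral a"
  by (auto simp: mask_def)

end

theorem theorem9:
  fixes K :: "('k, 'm) ring_scheme"
    and I :: "'i set"
    and A :: "'i \<Rightarrow> ('k, 'a, 'n) module_scheme"
    and B :: "('k, 'b, 'p) module_scheme"
    and f :: "('i \<Rightarrow> 'a) \<Rightarrow> 'b"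
  assumes K: "field K" "infinite (carrier K)"
    and A: "\<And>i. i \<in> I \<Longrightarrow> nonassoc_algebra K (A i)"
    and B: "nonassoc_algebra K B"
    and f: "f \<in> alg_hom K (prod_alg I A) B" "f ` carrier (prod_alg I A) = carrier B"
    and cases:
      "vdim K B <o |carrier K| \<and> |I| \<le>o |carrier K| \<or>
       vdim K B <o ctwo ^c natLeq \<and> |I| =o natLeq \<or>
       vdim K B <o natLeq \<and> below_measurables I (carrier K)"
  shows "carrier B = f ` fin_supp I A <+>\<^bsub>B\<^esub> tot_ann B \<and>
    (\<exists>f1 \<in> alg_hom K (prod_alg I A) B. \<exists>f0 \<in> alg_hom K (prod_alg I A) (tot_ann_alg B).
       (\<exists>J. finite J \<and> J \<subseteq> I \<and>
         (\<exists>g \<in> alg_hom K (prod_alg J A) B.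
            \<forall>a\<in>carrier (prod_alg I A). f1 a = g (restrict a J))) \<and>
       (\<forall>a\<in>carrier (prod_alg I A). f a = f1 a \<oplus>\<^bsub>B\<^esub> f0 a))"
proof -
  interpret H: product_hom K I A B f by (intro product_hom.intro K A B f)
  obtain S where S: "lin_basis K B S" "vdim K B = |S|"
    using vdim_basis[OF K(1) H.B.module_axioms] by blast
  interpret H: product_hom_kernel K I A B f
  proof
    fix a assume a: "a \<in> carrier (prod_alg I A)"
    interpret E: evaluation K B I "\<lambda>u. f (H.scale a u)" by (rule H.evaluation_scale[OF a K(2)])
    consider "|S| <o |carrier K|" "|I| \<le>o |carrier K|" | "|S| <o ctwo ^c natLeq" "|I| =o natLeq"
      | "finite S" "below_measurables I (carrier K)"
      using cases unfolding S(2) finite_iff_ordLess_natLeq by blast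
    then show "\<exists>u. u \<in> I \<rightarrow> carrier K \<and> finite {i \<in> I. u i = \<zero>\<^bsub>K\<^esub>} \<and> f (H.scale a u) = \<zero>\<^bsub>B\<^esub>"
    proof cases
      case 1
      then show ?thesis using E.kernel_of_card_le[OF S(1)] by metis
    next
      case 2
      then show ?thesis using E.kernel_of_continuum[OF S(1)] by metis
    next
      case 3
      then show ?thesis using E.kernel_of_below_measurables[OF S(1)] by metis
    qed
  qed
  \<comment> \<open>\<open>f1\<close> and \<open>g\<close> share one formula, because restricting
    \<open>a\<close> to \<open>noncentral\<close> does not change
    \<open>mask noncentral a\<close>.\<close>
  have g: "\<exists>g \<in> alg_hom K (prod_alg H.noncentral A) B. \<forall>a\<in>carrier (prod_alg I A). f (H.mask H.noncentral a) = g (restrict a H.noncentral)"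
    by (rule bexI[OF _ H.extend_hom]) (simp add: H.mask_restrict)
  have "H.noncentral \<subseteq> I" by (auto simp: H.noncentral_def)
  with g have J: "\<exists>J. finite J \<and> J \<subseteq> I \<and> (\<exists>g \<in> alg_hom K (prod_alg J A) B.
      \<forall>a\<in>carrier (prod_alg I A). f (H.mask H.noncentral a) = g (restrict a J))"
    by (intro exI[of _ H.noncentral] conjI H.finite_noncentral)
  show ?thesis
  proof (rule conjI[OF H.carrier_decomposition], rule bexI[OF _ H.mask_hom[of H.noncentral]],
      rule bexI[OF _ H.mask_tot_ann_hom], rule conjI[OF J], rule ballI)
    show "f a = f (H.mask H.noncentral a) \<oplus>\<^bsub>B\<^esub> f (H.mask (I - H.noncentral) a)" if "a \<in> carrier (prod_alg I A)" for a
      using that by (rule H.f_split)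
  qed
qed

end
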